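(* Let $b_0$ and $s_0$ satisfy the standing assumptions listed in the context, where $\lambda\in(0,1]$ is the Hölder exponent of $s_0$, and let $\Pi_n(\,\cdot\mid\mathcal X_n)$ be the posterior obtained from the histogram-type prior with independent inverse gamma $\mathrm{IG}(\alpha,\beta)$ coefficients ($\alpha,\beta>0$ fixed) on $N_n$ bins and the driftless Gaussian pseudo-likelihood. Assume $N_n\asymp n^{1/(2\lambda+1)}$ and let $\varepsilon_n\asymp n^{-\lambda/(2\lambda+1)}$. Then for any sequence $h_n$ tending to infinity as $n\to\infty$, $$\mathbb E_{b_0,s_0}\Big[\Pi_n\big(\|s^2-s_0^2\|_2\ge h_n\varepsilon_n\mid \mathcal X_n\big)\Big]\to 0\qquad\text{as } n\to\infty,$$ where $\|\cdot\|_2$ is the $L_2$-norm with respect to Lebesgue measure on $[0,1]$.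
   Context: Model and standing assumptions. $X$ is the strong solution of $dX_t=b_0(t,X_t)\,dt+s_0(t)\,dW_t$, $X_0=0$, $t\in[0,1]$, with $W$ a standard Brownian motion. The drift $b_0:[0,1]\times\mathbb R\to\mathbb R$ is (measurable and) such that for some $K>0$: $|b_0(t,x)|^2\le K(1+|x|^2)$ and $|b_0(t,x)-b_0(t,y)|\le K|x-y|$ for all $t\in[0,1]$, $x,y\in\mathbb R$. The deterministic dispersion coefficient $s_0:[0,1]\to(0,\infty)$ satisfies $|s_0(u)-s_0(v)|\le L|u-v|^\lambda$ for all $u,v\in[0,1]$, with $L>0$, $\lambda\in(0,1]$, and is bounded away from zero (and, by continuity, from infinity). $\mathbb P_{b_0,s_0}$ denotes the law of the path of $X$ and $\mathbb E_{b_0,s_0}$ the expectation under it. The data are $\mathcal X_n=\{X_{t_{0,n}},\dots,X_{t_{n,n}}\}$ with $t_{i,n}=i/n$; put $Y_{i,n}=X_{t_{i,n}}-X_{t_{i-1,n}}$. Bins. Given an integer $m=m_n<n$, write $n=mN+r$ with $0\le r<m$, $N=N_n=\lfloor n/m\rfloor$. The bins are $B_k=[t_{m(k-1),n},t_{mk,n})$ for $k=1,\dots,N-1$ and $B_N=[t_{m(N-1),n},1]$. Prior. Under $\Pi_n$, $s=\sum_{k=1}^{N_n}\xi_k\mathbf 1_{B_k}$ with $\xi_k>0$ and $s^2=\sum_{k=1}^{N_n}\theta_k\mathbf 1_{B_k}$, $\theta_k=\xi_k^2$, where $\theta_1,\dots,\theta_{N_n}$ are independent $\mathrm{IG}(\alpha,\beta)$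 (density proportional to $\theta^{-(\alpha+1)}e^{-\beta/\theta}$ on $(0,\infty)$), with $\alpha,\beta>0$ not depending on $n$. Posterior. The pseudo-likelihood (acting as if the drift were zero) is $$L_n(s)=\prod_{i=1}^n\frac{1}{\sqrt{2\pi\int_{t_{i-1,n}}^{t_{i,n}}s^2(u)\,du}}\exp\Big(-\frac{Y_{i,n}^2}{2\int_{t_{i-1,n}}^{t_{i,n}}s^2(u)\,du}\Big),$$ and $\Pi_n(S\mid\mathcal X_n)=\int_S L_n(s)\,\Pi_n(ds)\big/\int L_n(s)\,\Pi_n(ds)$. Notation. $a_n\asymp b_n$ for positive sequences means that each is bounded by a constant (independent of $n$) times the other. *)

theory Defs
  imports "HOL-Probability.Probability" "HOL-Library.Landau_Symbols"
begin

section \<open>Brownian motion and Wiener integrals on the unit interval\<close>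

definition standard_Brownian_motion :: "'w measure \<Rightarrow> (real \<Rightarrow> 'w \<Rightarrow> real) \<Rightarrow> bool" where
  "standard_Brownian_motion M W \<longleftrightarrow>
     (\<forall>t\<in>{0..1}. W t \<in> borel_measurable M) \<and>
     (AE \<omega> in M. W 0 \<omega> = 0) \<and>
     (AE \<omega> in M. continuous_on {0..1} (\<lambda>t. W t \<omega>)) \<and>
     (\<forall>u t. 0 \<le> u \<and> u < t \<and> t \<le> 1 \<longrightarrow>
        distributed M lborel (\<lambda>\<omega>. W t \<omega> - W u \<omega>) (normal_density 0 (sqrt (t - u)))) \<and>
     (\<forall>k (p :: nat \<Rightarrow> real). (\<forall>i\<le>k. p i \<in> {0..1}) \<and> (\<forall>i<k. p i < p (Suc i)) \<longrightarrow>
        prob_space.indep_vars M (\<lambda>_. borel) (\<lambda>i \<omega>. W (p (Suc i)) \<omega> - W (p i) \<omega>) {..<k})"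

definition step_function :: "nat \<Rightarrow> (nat \<Rightarrow> real) \<Rightarrow> (nat \<Rightarrow> real) \<Rightarrow> real \<Rightarrow> real" where
  "step_function k p c u = (\<Sum>i<k. c i * indicator {p i<..p (Suc i)} u)"

definition step_integral ::
  "(real \<Rightarrow> 'w \<Rightarrow> real) \<Rightarrow> nat \<Rightarrow> (nat \<Rightarrow> real) \<Rightarrow> (nat \<Rightarrow> real) \<Rightarrow> 'w \<Rightarrow> real" where
  "step_integral W k p c \<omega> = (\<Sum>i<k. c i * (W (p (Suc i)) \<omega> - W (p i) \<omega>))"

text \<open>The stochastic integral of a deterministic square-integrable integrand: \<open>J\<close> is a version
  of the integral of \<open>f\<close> against \<open>W\<close> over \<open>[0,t]\<close> if step functions
  converge to \<open>f\<close> in \<open>L\<^sup>2[0,t]\<close> while their integrals converge to \<open>J\<close> in \<open>L\<^sup>2(M)\<close>. By the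
  Ito isometry the choice of the approximating sequence is immaterial. The \<open>L\<^sup>2\<close> distances are
  nonnegative integrals, because the Bochner integral of a non-integrable function is 0.\<close>

definition is_Wiener_integral ::
  "'w measure \<Rightarrow> (real \<Rightarrow> 'w \<Rightarrow> real) \<Rightarrow> (real \<Rightarrow> real) \<Rightarrow> real \<Rightarrow> ('w \<Rightarrow> real) \<Rightarrow> bool" where
  "is_Wiener_integral M W f t J \<longleftrightarrow>
     J \<in> borel_measurable M \<and> set_borel_measurable lborel {0..t} f \<and>
     (\<exists>(k :: nat \<Rightarrow> nat) (p :: nat \<Rightarrow> nat \<Rightarrow> real) (c :: nat \<Rightarrow> nat \<Rightarrow> real).
        (\<forall>j. p j 0 = 0 \<and> p j (k j) = t \<and> (\<forall>i<k j. p j i \<le> p j (Suc i))) \<and>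
        (\<lambda>j. \<integral>\<^sup>+u\<in>{0..t}. ennreal ((step_function (k j) (p j) (c j) u - f u)\<^sup>2) \<partial>lborel)
          \<longlonglongrightarrow> 0 \<and>
        (\<lambda>j. \<integral>\<^sup>+\<omega>. ennreal ((step_integral W (k j) (p j) (c j) \<omega> - J \<omega>)\<^sup>2) \<partial>M)
          \<longlonglongrightarrow> 0)"

definition is_Wiener_integral_process ::
  "'w measure \<Rightarrow> (real \<Rightarrow> 'w \<Rightarrow> real) \<Rightarrow> (real \<Rightarrow> real) \<Rightarrow> (real \<Rightarrow> 'w \<Rightarrow> real) \<Rightarrow> bool" where
  "is_Wiener_integral_process M W f J \<longleftrightarrow>
     (\<forall>t\<in>{0..1}. is_Wiener_integral M W f t (J t)) \<and>
     (AE \<omega> in M. continuous_on {0..1} (\<lambda>t. J t \<omega>))"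


section \<open>Strong solutions\<close>

definition augmented_filtration :: "'w measure \<Rightarrow> (real \<Rightarrow> 'w \<Rightarrow> real) \<Rightarrow> real \<Rightarrow> 'w measure" where
  "augmented_filtration M W t =
     sigma (space M)
       ({W u -` A \<inter> space M | u A. u \<in> {0..t} \<and> A \<in> sets borel} \<union> null_sets M)"

text \<open>Strong solution of \<open>dX\<^sub>t = b(t,X\<^sub>t) dt + s(t) dW\<^sub>t\<close>, \<open>X\<^sub>0 = 0\<close>, on \<open>[0,1]\<close>.\<close>

definition strong_solution ::
  "'w measure \<Rightarrow> (real \<Rightarrow> 'w \<Rightarrow> real) \<Rightarrow> (real \<Rightarrow> real \<Rightarrow> real) \<Rightarrow> (real \<Rightarrow> real)
     \<Rightarrow> (real \<Rightarrow> 'w \<Rightarrow> real) \<Rightarrow> bool" where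
  "strong_solution M W b s X \<longleftrightarrow>
     (\<forall>t\<in>{0..1}. X t \<in> borel_measurable (augmented_filtration M W t)) \<and>
     (AE \<omega> in M. X 0 \<omega> = 0) \<and>
     (AE \<omega> in M. continuous_on {0..1} (\<lambda>t. X t \<omega>)) \<and>
     (\<exists>J. is_Wiener_integral_process M W s J \<and>
        (AE \<omega> in M. \<forall>t\<in>{0..1}.
           set_integrable lborel {0..t} (\<lambda>u. b u (X u \<omega>)) \<and>
           X t \<omega> = (LBINT u:{0..t}. b u (X u \<omega>)) + J t \<omega>))"

definition path_law :: "'w measure \<Rightarrow> (real \<Rightarrow> 'w \<Rightarrow> real) \<Rightarrow> (real \<Rightarrow> real) measure" where
  "path_law M X = distr M (\<Pi>\<^sub>M t\<in>{0..1}. borel) (\<lambda>\<omega>. \<lambda>t\<in>{0..1}. X t \<omega>)"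

definition drift_condition :: "real \<Rightarrow> (real \<Rightarrow> real \<Rightarrow> real) \<Rightarrow> bool" where
  "drift_condition K b \<longleftrightarrow>
     (\<lambda>(t, x). b t x) \<in> borel_measurable (restrict_space borel ({0..1} \<times> UNIV)) \<and>
     (\<forall>t\<in>{0..1}. \<forall>x. \<bar>b t x\<bar>\<^sup>2 \<le> K * (1 + x\<^sup>2)) \<and>
     (\<forall>t\<in>{0..1}. \<forall>x y. \<bar>b t x - b t y\<bar> \<le> K * \<bar>x - y\<bar>)"

definition dispersion_condition :: "real \<Rightarrow> real \<Rightarrow> (real \<Rightarrow> real) \<Rightarrow> bool" where
  "dispersion_condition L lam s \<longleftrightarrow>
     (\<forall>u\<in>{0..1}. s u > 0) \<and>
     (\<forall>u\<in>{0..1}. \<forall>v\<in>{0..1}. \<bar>s u - s v\<bar> \<le> L * \<bar>u - v\<bar> powr lam) \<and>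
     (\<exists>c>0. \<forall>u\<in>{0..1}. c \<le> s u)"


section \<open>Prior, pseudo-likelihood and posterior\<close>

definition num_bins :: "nat \<Rightarrow> nat \<Rightarrow> nat" where
  "num_bins n m = n div m"

definition bin :: "nat \<Rightarrow> nat \<Rightarrow> nat \<Rightarrow> real set" where
  "bin n m k =
     (if k = num_bins n m then {real (m * (k - 1)) / real n .. 1}
      else {real (m * (k - 1)) / real n ..< real (m * k) / real n})"

definition inverse_gamma :: "real \<Rightarrow> real \<Rightarrow> real measure" where
  "inverse_gamma \<alpha> \<beta> = density lborel (\<lambda>\<theta>. ennreal
     (if \<theta> > 0 then \<beta> powr \<alpha> / Gamma \<alpha> * \<theta> powr (- (\<alpha> + 1)) * exp (- \<beta> / \<theta>) else 0))"

text \<open>The prior is carried by the coefficient vectors \<open>\<theta>\<close>; the prior on functions is its image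
  under \<open>hist_function\<close>, and integrals over functions are written as integrals over \<open>\<theta>\<close>.
  This avoids a choice of \<open>\<sigma>\<close>-algebra on the function space (\<open>L\<^sup>2\<close>-neighbourhoods are not measurable
  for the product \<open>\<sigma>\<close>-algebra).\<close>

definition coeff_prior :: "real \<Rightarrow> real \<Rightarrow> nat \<Rightarrow> nat \<Rightarrow> (nat \<Rightarrow> real) measure" where
  "coeff_prior \<alpha> \<beta> n m = (\<Pi>\<^sub>M k\<in>{1..num_bins n m}. inverse_gamma \<alpha> \<beta>)"

definition hist_function :: "nat \<Rightarrow> nat \<Rightarrow> (nat \<Rightarrow> real) \<Rightarrow> real \<Rightarrow> real" where
  "hist_function n m \<theta> u = (\<Sum>k=1..num_bins n m. sqrt (\<theta> k) * indicator (bin n m k) u)"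

definition obs_increment :: "nat \<Rightarrow> (real \<Rightarrow> real) \<Rightarrow> nat \<Rightarrow> real" where
  "obs_increment n x i = x (real i / real n) - x (real (i - 1) / real n)"

definition pseudo_likelihood :: "nat \<Rightarrow> (real \<Rightarrow> real) \<Rightarrow> (real \<Rightarrow> real) \<Rightarrow> real" where
  "pseudo_likelihood n x s =
     (\<Prod>i=1..n. let v = (LBINT u:{real (i - 1) / real n .. real i / real n}. (s u)\<^sup>2)
        in 1 / sqrt (2 * pi * v) * exp (- (obs_increment n x i)\<^sup>2 / (2 * v)))"

definition posterior ::
  "real \<Rightarrow> real \<Rightarrow> nat \<Rightarrow> nat \<Rightarrow> (real \<Rightarrow> real) \<Rightarrow> (real \<Rightarrow> real) set \<Rightarrow> real" where
  "posterior \<alpha> \<beta> n m x S =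
     (\<integral>\<theta>. indicator S (hist_function n m \<theta>) * pseudo_likelihood n x (hist_function n m \<theta>)
        \<partial>coeff_prior \<alpha> \<beta> n m)
     / (\<integral>\<theta>. pseudo_likelihood n x (hist_function n m \<theta>) \<partial>coeff_prior \<alpha> \<beta> n m)"

definition L2_norm_01 :: "(real \<Rightarrow> real) \<Rightarrow> real" where
  "L2_norm_01 f = sqrt (LBINT u:{0..1}. (f u)\<^sup>2)"

end

theory Submission
  imports Defs
begin

text \<open>Given the data, the coefficients \<open>\<theta>\<^sub>1, \<dots>, \<theta>\<^sub>N\<close> are independent, because the Gaussian
pseudo-likelihood of a histogram factorises over the bins, and the inverse gamma prior is
conjugate to each factor: on a bin with \<open>w\<close> observation cells the posterior of \<open>\<theta>\<^sub>k\<close> is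
\<open>IG (\<alpha> + w/2) (\<beta> + n Z/2)\<close>, where \<open>Z\<close> is the sum of the squared increments over the bin. Its mean is
\<open>n Z / w\<close> up to an error of order \<open>1/w\<close>, and its variance is of order \<open>1/w\<close>. So the posterior
expectation of the squared \<open>L\<^sup>2\<close> distance to \<open>s\<^sub>0\<^sup>2\<close> is a sum of bin risks that can be written down,
and Markov's inequality turns it into a bound on the posterior mass outside an \<open>L\<^sup>2\<close> ball
(\<open>posterior_histogram_bounds\<close>).

It remains to see how well \<open>n Z / w\<close> estimates \<open>s\<^sub>0\<^sup>2\<close> on a bin. Without the drift, \<open>Z\<close> would be the sum
\<open>Q\<close> of the squares of independent centred Gaussian increments of the Wiener integral of \<open>s\<^sub>0\<close>, and
\<open>n Q / w\<close> has bias at most the oscillation of \<open>s\<^sub>0\<^sup>2\<close> on the bin and variance at most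
\<open>2 (sup s\<^sub>0)\<^sup>4 / w\<close> (\<open>realized_variance_moment\<close>). This is first computed for Riemann sums, which are
sums of independent normal variables, and is carried to the Wiener integral by Fatou's
lemma. The drift shifts each increment by at most \<open>c / n\<close> as long as the path stays in a fixed
interval \<open>[-R, R]\<close>; this perturbs \<open>n Z / w\<close> by a term whose square is of order \<open>1/w\<close>
(\<open>perturbed_sum_squares_close\<close>).

With bins of about \<open>m\<close> cells the expected posterior risk on the event that the path stays in
\<open>[-R, R]\<close> is thus of order \<open>1/m + (m/n)\<^bsup>2\<lambda>\<^esup>\<close>, which for \<open>n/m \<asymp> n\<^bsup>1/(2\<lambda>+1)\<^esup>\<close> is of the order of
\<open>\<epsilon>\<^sub>n\<^sup>2\<close> (\<open>expected_posterior_bound\<close>, \<open>bin_width_rate\<close>). Off that event the posterior mass is at most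
\<open>1\<close>. Hence the limit superior of the expected posterior mass is at most the probability that the path
leaves \<open>[-R, R]\<close>, for every \<open>R\<close>, and this probability tends to \<open>0\<close> because paths are continuous.\<close>

section \<open>Inverse gamma integrals and conjugacy on one bin\<close>

definition ig_kernel :: "real \<Rightarrow> real \<Rightarrow> real \<Rightarrow> real" where
  "ig_kernel a b \<theta> = (if \<theta> > 0 then \<theta> powr (- (a + 1)) * exp (- b / \<theta>) else 0)"

lemma ig_kernel_measurable [measurable]: "ig_kernel a b \<in> borel_measurable borel"
  unfolding ig_kernel_def[abs_def] by measurable

text \<open>The substitution \<open>\<theta> = b / t\<close> turns the integral into Euler's integral for \<open>Gamma a\<close>.\<close>

lemma has_bochner_integral_ig_kernel:
  assumes a: "a > 0" and b: "b > 0"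
  shows "has_bochner_integral lborel (ig_kernel a b) (Gamma a / b powr a)"
proof -
  define f where "f t = (t :: real) powr (a - 1) / exp t" for t
  define F where "F \<theta> = \<bar>- b / \<theta>\<^sup>2\<bar> * f (b / \<theta>)" for \<theta>
  have "(f has_integral Gamma a) {0..}"
    unfolding f_def using Gamma_integral_real[OF a] .
  then have int_f: "(f has_integral Gamma a) {0<..}"
    by (rule has_integral_spike_set_eq[THEN iffD1, rotated -1])
      (auto intro: negligible_subset[of "{0}"])
  have "f absolutely_integrable_on {0<..}"
    using int_f by (intro nonnegative_absolutely_integrable_1) (auto simp: f_def has_integral_iff)
  moreover have "(\<lambda>\<theta>. b / \<theta>) ` {0<..} = {0<..}"
  proof (rule antisym)
    show "{0<..} \<subseteq> (\<lambda>\<theta>. b / \<theta>) ` {0<..}"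
    proof
      fix y :: real assume "y \<in> {0<..}"
      then show "y \<in> (\<lambda>\<theta>. b / \<theta>) ` {0<..}" using b by (intro image_eqI[of _ _ "b / y"]) auto
    qed
  qed (use b in auto)
  ultimately have F: "F absolutely_integrable_on {0<..} \<and> integral {0<..} F = Gamma a"
    unfolding F_def[abs_def] using b int_f
    by (subst has_absolute_integral_change_of_variables_1'[where g = "\<lambda>\<theta>. b / \<theta>"])
      (auto simp: has_integral_iff inj_on_def field_simps power2_eq_square intro!: derivative_eq_intros)
  have eq: "indicator {0<..} \<theta> *\<^sub>R F \<theta> = b powr a * ig_kernel a b \<theta>" for \<theta>
  proof (cases "\<theta> > 0")
    case True
    have "b / \<theta>\<^sup>2 * (b / \<theta>) powr (a - 1) = b powr a * \<theta> powr (- (a + 1))"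
    proof -
      have "b / \<theta>\<^sup>2 = b powr 1 * \<theta> powr (- 2)"
        using True b by (simp add: powr_minus divide_inverse powr_numeral)
      moreover have "(b / \<theta>) powr (a - 1) = b powr (a - 1) * \<theta> powr (- (a - 1))"
        using True b by (simp add: powr_divide powr_minus divide_inverse[of _ "\<theta> powr _"] del: minus_diff_eq)
      ultimately have "b / \<theta>\<^sup>2 * (b / \<theta>) powr (a - 1) =
          (b powr 1 * b powr (a - 1)) * (\<theta> powr (- 2) * \<theta> powr (- (a - 1)))"
        by (simp add: mult_ac)
      also have "\<dots> = b powr (1 + (a - 1)) * \<theta> powr (- 2 + - (a - 1))"
        by (simp only: powr_add)
      also have "\<dots> = b powr a * \<theta> powr (- (a + 1))"
        by (simp add: algebra_simps)
      finally show ?thesis .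
    qed
    then show ?thesis using True b
      by (simp add: F_def f_def ig_kernel_def exp_minus divide_inverse mult_ac)
  qed (simp add: ig_kernel_def)
  have "set_integrable lebesgue {0<..} F" using F by simp
  then have "integrable lebesgue (\<lambda>\<theta>. b powr a * ig_kernel a b \<theta>)"
    unfolding set_integrable_def eq .
  then have int: "integrable lborel (\<lambda>\<theta>. b powr a * ig_kernel a b \<theta>)"
    by (subst (asm) integrable_completion) auto
  have "integral {0<..} F = (LINT \<theta>:{0<..}|lebesgue. F \<theta>)"
    using F by (simp add: set_lebesgue_integral_eq_integral)
  also have "\<dots> = (\<integral>\<theta>. b powr a * ig_kernel a b \<theta> \<partial>lebesgue)"
    unfolding set_lebesgue_integral_def eq ..
  also have "\<dots> = (\<integral>\<theta>. b powr a * ig_kernel a b \<theta> \<partial>lborel)"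
    by (subst integral_completion) auto
  finally have "b powr a * (\<integral>\<theta>. ig_kernel a b \<theta> \<partial>lborel) = Gamma a"
    using F by simp
  then have "(\<integral>\<theta>. ig_kernel a b \<theta> \<partial>lborel) = Gamma a / b powr a"
    using b by (auto simp: field_simps)
  moreover have "integrable lborel (ig_kernel a b)"
    using int b by auto
  ultimately show ?thesis by (simp add: has_bochner_integral_iff)
qed

text \<open>Multiplication by \<open>\<theta>\<close> lowers the first parameter of the kernel by one, so the first two moments are
quotients of Gamma values: the mean is \<open>b / (a - 1)\<close> and the variance \<open>(b / (a - 1))\<^sup>2 / (a - 2)\<close>.\<close>

lemma has_bochner_integral_ig_kernel_sq_dist:
  assumes a: "a > 2" and b: "b > 0"
  shows "has_bochner_integral lborel (\<lambda>\<theta>. (\<bar>\<theta>\<bar> - c)\<^sup>2 * ig_kernel a b \<theta>)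
           (Gamma a / b powr a * ((b / (a - 1) - c)\<^sup>2 + (b / (a - 1))\<^sup>2 / (a - 2)))"
proof -
  have shift: "\<theta> * ig_kernel a' b \<theta> = ig_kernel (a' - 1) b \<theta>" for \<theta> a'
  proof (cases "\<theta> > 0")
    case True
    then have "\<theta> * \<theta> powr (- (a' + 1)) = \<theta> powr (1 + (- (a' + 1)))"
      by (simp only: powr_add powr_one)
    then show ?thesis using True by (simp add: ig_kernel_def)
  qed (simp add: ig_kernel_def)
  have eq: "(\<bar>\<theta>\<bar> - c)\<^sup>2 * ig_kernel a b \<theta> =
      ig_kernel (a - 2) b \<theta> - 2 * c * ig_kernel (a - 1) b \<theta> + c\<^sup>2 * ig_kernel a b \<theta>" for \<theta>
  proof (cases "\<theta> > 0")
    case True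
    then have "(\<bar>\<theta>\<bar> - c)\<^sup>2 * ig_kernel a b \<theta> =
       \<theta> * (\<theta> * ig_kernel a b \<theta>) - 2 * c * (\<theta> * ig_kernel a b \<theta>) + c\<^sup>2 * ig_kernel a b \<theta>"
      by (simp add: power2_eq_square algebra_simps)
    then show ?thesis by (simp add: shift)
  qed (simp add: ig_kernel_def)
  have rec: "Gamma (x + 1) = x * Gamma x" if "x > 0" for x :: real
    using that by (intro Gamma_plus1) auto
  have G1: "Gamma a = (a - 1) * Gamma (a - 1)" using rec[of "a - 1"] a by simp
  have G2: "Gamma (a - 1) = (a - 2) * Gamma (a - 2)" using rec[of "a - 2"] a by simp
  have p1: "b powr (a - 1) = b powr a / b" using b by (simp add: powr_diff)
  have p2: "b powr (a - 2) = b powr a / b\<^sup>2" using b by (simp add: powr_diff powr_numeral)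
  have val: "Gamma (a - 2) / b powr (a - 2) - 2 * c * (Gamma (a - 1) / b powr (a - 1))
        + c\<^sup>2 * (Gamma a / b powr a)
      = Gamma a / b powr a * ((b / (a - 1) - c)\<^sup>2 + (b / (a - 1))\<^sup>2 / (a - 2))"
  proof -
    define P where "P = b powr a"
    have P: "P > 0" using b by (simp add: P_def)
    define x where "x = a - 2"
    have x: "x > 0" "a = x + 2" using a by (auto simp: x_def)
    \<comment> \<open>With \<open>u\<close> the mean, the identity becomes polynomial after cancelling \<open>x\<close>.\<close>
    define u where "u = b / (x + 1)"
    have b_eq: "b = u * (x + 1)" using x by (simp add: u_def)
    define r where "r = Gamma x / P"
    have t1: "Gamma x / (P / b\<^sup>2) = r * b\<^sup>2" by (simp add: r_def)
    have t2: "x * Gamma x / (P / b) = r * (x * b)" by (simp add: r_def)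
    have t3: "(x + 1) * (x * Gamma x) / P = r * ((x + 1) * x)" by (simp add: r_def)
    have "r * b\<^sup>2 - 2 * c * (r * (x * b)) + c\<^sup>2 * (r * ((x + 1) * x))
        = r * ((x + 1) * x) * (u - c)\<^sup>2 + r * (x + 1) * u\<^sup>2"
      unfolding b_eq by (simp add: algebra_simps power2_eq_square)
    also have "r * (x + 1) * u\<^sup>2 = r * ((x + 1) * x) * (u\<^sup>2 / x)"
      using x by simp
    finally have "r * b\<^sup>2 - 2 * c * (r * (x * b)) + c\<^sup>2 * (r * ((x + 1) * x))
        = r * ((x + 1) * x) * ((u - c)\<^sup>2 + u\<^sup>2 / x)"
      by (simp only: distrib_left)
    moreover have "a - 2 = x" "a - 1 = x + 1" using x by auto
    ultimately show ?thesis unfolding G1 G2 p1 p2 P_def[symmetric] by (simp only: t1 t2 t3 u_def)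
  qed
  show ?thesis
    unfolding eq val[symmetric] using a b
    by (intro has_bochner_integral_add has_bochner_integral_diff has_bochner_integral_mult_right
        has_bochner_integral_ig_kernel) auto
qed

lemma inverse_gamma_eq:
  "inverse_gamma \<alpha> \<beta> = density lborel (\<lambda>\<theta>. ennreal (\<beta> powr \<alpha> / Gamma \<alpha> * ig_kernel \<alpha> \<beta> \<theta>))"
  unfolding inverse_gamma_def ig_kernel_def by (intro arg_cong2[of _ _ _ _ density] refl ext) (simp add: mult_ac)

lemma sets_inverse_gamma [simp, measurable_cong]: "sets (inverse_gamma \<alpha> \<beta>) = sets borel"
  by (simp add: inverse_gamma_def)

lemma ig_kernel_nonneg: "ig_kernel a b \<theta> \<ge> 0"
  by (simp add: ig_kernel_def)

lemma sigma_finite_inverse_gamma: "sigma_finite_measure (inverse_gamma \<alpha> \<beta>)"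
  unfolding inverse_gamma_eq
  by (subst sigma_finite_measure.sigma_finite_iff_density_finite[OF sigma_finite_lborel]) auto

lemma has_bochner_integral_inverse_gamma:
  assumes "\<alpha> > 0" and "f \<in> borel_measurable borel"
    and "has_bochner_integral lborel (\<lambda>\<theta>. f \<theta> * ig_kernel \<alpha> \<beta> \<theta>) I"
  shows "has_bochner_integral (inverse_gamma \<alpha> \<beta>) f (\<beta> powr \<alpha> / Gamma \<alpha> * I)"
proof -
  have nn: "0 \<le> \<beta> powr \<alpha> / Gamma \<alpha> * ig_kernel \<alpha> \<beta> \<theta>" for \<theta>
    using assms(1) by (simp add: ig_kernel_nonneg Gamma_real_nonneg)
  have "has_bochner_integral lborel (\<lambda>\<theta>. \<beta> powr \<alpha> / Gamma \<alpha> * (f \<theta> * ig_kernel \<alpha> \<beta> \<theta>))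
      (\<beta> powr \<alpha> / Gamma \<alpha> * I)"
    by (rule has_bochner_integral_mult_right) (rule assms)
  then show ?thesis
    unfolding inverse_gamma_eq using nn assms(2)
    by (intro has_bochner_integral_density) (auto simp: mult_ac)
qed

text \<open>The contribution of the cells \<open>I\<close> to the pseudo-likelihood when the squared dispersion is constant
on them. The absolute value appears because \<open>sqrt\<close> is an odd function on the reals: the
histogram with coefficient \<open>sqrt \<theta>\<close> has square \<open>\<bar>\<theta>\<bar>\<close>, also at the negative arguments, which carry no
prior mass.\<close>

definition gauss_block :: "nat \<Rightarrow> nat set \<Rightarrow> (nat \<Rightarrow> real) \<Rightarrow> real \<Rightarrow> real" where
  "gauss_block n I y \<theta> =
     (\<Prod>i\<in>I. 1 / sqrt (2 * pi * (\<bar>\<theta>\<bar> / real n)) * exp (- (y i)\<^sup>2 / (2 * (\<bar>\<theta>\<bar> / real n))))"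

text \<open>Conjugacy: a Gaussian factor in the variance \<open>\<theta>\<close> times an inverse gamma kernel is again an inverse
gamma kernel.\<close>

lemma gauss_block_conjugate:
  fixes \<alpha> \<beta> :: real and y :: "nat \<Rightarrow> real"
  assumes n: "n > 0" and fin: "finite I"
  defines "A \<equiv> \<alpha> + real (card I) / 2" and "B \<equiv> \<beta> + real n * (\<Sum>i\<in>I. (y i)\<^sup>2) / 2"
  shows "gauss_block n I y \<theta> * ig_kernel \<alpha> \<beta> \<theta>
         = (real n / (2 * pi)) powr (real (card I) / 2) * ig_kernel A B \<theta>"
proof (cases "\<theta> > 0")
  case True
  define w where "w = card I"
  define C where "C = real n / (2 * pi)"
  have C: "C > 0" using n by (simp add: C_def)
  have fac: "1 / sqrt (2 * pi * (\<theta> / real n)) = C powr (1 / 2) * \<theta> powr (- (1 / 2))"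
  proof -
    have "1 / sqrt (2 * pi * (\<theta> / real n)) = sqrt (C / \<theta>)"
      by (simp add: C_def real_sqrt_divide real_sqrt_mult)
    also have "\<dots> = C powr (1 / 2) * \<theta> powr (- (1 / 2))"
    proof -
      have "\<theta> powr (- (1 / 2)) = 1 / sqrt \<theta>"
        unfolding powr_minus_divide using True by (simp add: powr_half_sqrt)
      moreover have "C powr (1 / 2) = sqrt C" using C by (simp add: powr_half_sqrt)
      ultimately show ?thesis by (simp add: real_sqrt_divide)
    qed
    finally show ?thesis .
  qed
  have "gauss_block n I y \<theta> = (\<Prod>i\<in>I. C powr (1 / 2) * \<theta> powr (- (1 / 2))) *
      (\<Prod>i\<in>I. exp (- (y i)\<^sup>2 / (2 * (\<theta> / real n))))"
    unfolding prod.distrib[symmetric] gauss_block_def fac[symmetric] using True by simp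
  also have "(\<Prod>i\<in>I. C powr (1 / 2) * \<theta> powr (- (1 / 2))) = C powr (real w / 2) * \<theta> powr (- (real w / 2))"
    using True C by (simp add: w_def power_mult_distrib powr_power)
  also have "(\<Prod>i\<in>I. exp (- (y i)\<^sup>2 / (2 * (\<theta> / real n)))) = exp (- (real n * (\<Sum>i\<in>I. (y i)\<^sup>2) / 2) / \<theta>)"
  proof -
    have "(\<Sum>i\<in>I. - (y i)\<^sup>2 / (2 * (\<theta> / real n))) = (\<Sum>i\<in>I. - (y i)\<^sup>2) / (2 * (\<theta> / real n))"
      by (rule sum_divide_distrib[symmetric])
    also have "\<dots> = - (real n * (\<Sum>i\<in>I. (y i)\<^sup>2) / 2) / \<theta>"
      unfolding sum_negf using True n by (simp add: divide_simps)
    finally show ?thesis by (simp add: exp_sum[OF fin, symmetric])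
  qed
  finally have "gauss_block n I y \<theta> * ig_kernel \<alpha> \<beta> \<theta> =
      C powr (real w / 2) * (\<theta> powr (- (real w / 2)) * \<theta> powr (- (\<alpha> + 1))) *
      (exp (- (real n * (\<Sum>i\<in>I. (y i)\<^sup>2) / 2) / \<theta>) * exp (- \<beta> / \<theta>))"
    using True by (simp add: ig_kernel_def)
  also have "\<theta> powr (- (real w / 2)) * \<theta> powr (- (\<alpha> + 1)) = \<theta> powr (- (A + 1))"
    by (simp add: powr_add[symmetric] A_def w_def algebra_simps)
  also have "exp (- (real n * (\<Sum>i\<in>I. (y i)\<^sup>2) / 2) / \<theta>) * exp (- \<beta> / \<theta>) = exp (- B / \<theta>)"
    unfolding exp_add[symmetric] B_def by (simp add: diff_divide_distrib algebra_simps)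
  finally show ?thesis using True by (simp add: ig_kernel_def C_def w_def)
qed (simp add: ig_kernel_def)

lemma gauss_block_measurable [measurable]: "gauss_block n I y \<in> borel_measurable borel"
  unfolding gauss_block_def[abs_def] by measurable

text \<open>The mean of the posterior \<open>IG (\<alpha> + card I / 2) (\<beta> + n \<Sum>y\<^sup>2 / 2)\<close> of one coefficient.\<close>

definition posterior_bin_mean :: "real \<Rightarrow> real \<Rightarrow> nat \<Rightarrow> nat set \<Rightarrow> (nat \<Rightarrow> real) \<Rightarrow> real" where
  "posterior_bin_mean \<alpha> \<beta> n I y =
     (\<beta> + real n * (\<Sum>i\<in>I. (y i)\<^sup>2) / 2) / (\<alpha> + real (card I) / 2 - 1)"

text \<open>Squared bias plus variance, that is, the posterior expectation of \<open>(\<theta> - c)\<^sup>2\<close>.\<close>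

definition posterior_bin_risk :: "real \<Rightarrow> real \<Rightarrow> nat \<Rightarrow> nat set \<Rightarrow> (nat \<Rightarrow> real) \<Rightarrow> real \<Rightarrow> real" where
  "posterior_bin_risk \<alpha> \<beta> n I y c =
     (posterior_bin_mean \<alpha> \<beta> n I y - c)\<^sup>2
     + (posterior_bin_mean \<alpha> \<beta> n I y)\<^sup>2 / (\<alpha> + real (card I) / 2 - 2)"

text \<open>Here \<open>D\<close> is the evidence of the bin, the factor by which the posterior is normalised; it cancels in
every posterior expectation.\<close>

lemma bin_posterior:
  fixes \<alpha> \<beta> :: real and y :: "nat \<Rightarrow> real"
  assumes n: "n > 0" and fin: "finite I" and "\<alpha> > 0" "\<beta> > 0" and w: "card I \<ge> 4"
  shows "\<exists>D>0. has_bochner_integral (inverse_gamma \<alpha> \<beta>) (gauss_block n I y) D \<and>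
    (\<forall>c. has_bochner_integral (inverse_gamma \<alpha> \<beta>) (\<lambda>\<theta>. (\<bar>\<theta>\<bar> - c)\<^sup>2 * gauss_block n I y \<theta>)
           (D * posterior_bin_risk \<alpha> \<beta> n I y c))"
proof -
  define A B where "A = \<alpha> + real (card I) / 2" and "B = \<beta> + real n * (\<Sum>i\<in>I. (y i)\<^sup>2) / 2"
  define C where "C = (real n / (2 * pi)) powr (real (card I) / 2)"
  define D where "D = \<beta> powr \<alpha> / Gamma \<alpha> * (C * (Gamma A / B powr A))"
  have A: "A > 2" using w assms by (simp add: A_def)
  have B: "B > 0" using assms by (simp add: B_def add_pos_nonneg sum_nonneg)
  have C: "C > 0" using n by (simp add: C_def)
  note conj = gauss_block_conjugate[OF n fin, of y _ \<alpha> \<beta>, folded A_def B_def C_def]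
  have "D > 0" using A B C assms by (simp add: D_def Gamma_real_pos)
  moreover have "has_bochner_integral (inverse_gamma \<alpha> \<beta>) (gauss_block n I y) D"
    unfolding D_def using A B assms(3)
    by (intro has_bochner_integral_inverse_gamma)
      (auto simp: conj simp del: times_divide_eq_right
        intro!: has_bochner_integral_mult_right has_bochner_integral_ig_kernel)
  moreover have "has_bochner_integral (inverse_gamma \<alpha> \<beta>) (\<lambda>\<theta>. (\<bar>\<theta>\<bar> - c)\<^sup>2 * gauss_block n I y \<theta>)
           (D * ((B / (A - 1) - c)\<^sup>2 + (B / (A - 1))\<^sup>2 / (A - 2)))" for c
  proof -
    have "has_bochner_integral lborel (\<lambda>\<theta>. C * ((\<bar>\<theta>\<bar> - c)\<^sup>2 * ig_kernel A B \<theta>))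
        (C * (Gamma A / B powr A * ((B / (A - 1) - c)\<^sup>2 + (B / (A - 1))\<^sup>2 / (A - 2))))"
      using A B by (intro has_bochner_integral_mult_right has_bochner_integral_ig_kernel_sq_dist) auto
    also have "(\<lambda>\<theta>. C * ((\<bar>\<theta>\<bar> - c)\<^sup>2 * ig_kernel A B \<theta>)) =
        (\<lambda>\<theta>. (\<bar>\<theta>\<bar> - c)\<^sup>2 * gauss_block n I y \<theta> * ig_kernel \<alpha> \<beta> \<theta>)"
    proof
      fix \<theta>
      have "C * ((\<bar>\<theta>\<bar> - c)\<^sup>2 * ig_kernel A B \<theta>) = (\<bar>\<theta>\<bar> - c)\<^sup>2 * (C * ig_kernel A B \<theta>)"
        by (simp only: mult_ac)
      then show "C * ((\<bar>\<theta>\<bar> - c)\<^sup>2 * ig_kernel A B \<theta>) =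
          (\<bar>\<theta>\<bar> - c)\<^sup>2 * gauss_block n I y \<theta> * ig_kernel \<alpha> \<beta> \<theta>"
        by (simp only: conj[symmetric] mult.assoc)
    qed
    finally have "has_bochner_integral (inverse_gamma \<alpha> \<beta>) (\<lambda>\<theta>. (\<bar>\<theta>\<bar> - c)\<^sup>2 * gauss_block n I y \<theta>)
      (\<beta> powr \<alpha> / Gamma \<alpha> * (C * (Gamma A / B powr A * ((B / (A - 1) - c)\<^sup>2 + (B / (A - 1))\<^sup>2 / (A - 2)))))"
      using assms(3) by (intro has_bochner_integral_inverse_gamma) auto
    then show ?thesis by (simp add: D_def mult_ac)
  qed
  ultimately show ?thesis
    unfolding posterior_bin_risk_def posterior_bin_mean_def A_def B_def by blast
qed

section \<open>Bins and histograms\<close>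

text \<open>The indices \<open>i\<close> of the observation cells \<open>[(i-1)/n, i/n]\<close> that make up the \<open>k\<close>-th bin; the last bin
also takes the cells left over when \<open>m\<close> does not divide \<open>n\<close>.\<close>

definition bin_cells :: "nat \<Rightarrow> nat \<Rightarrow> nat \<Rightarrow> nat set" where
  "bin_cells n m k = (if k = num_bins n m then {m * (k - 1) + 1..n} else {m * (k - 1) + 1..m * k})"

lemma finite_bin_cells [simp]: "finite (bin_cells n m k)"
  by (simp add: bin_cells_def)

lemma num_bins_pos: "0 < m \<Longrightarrow> m \<le> n \<Longrightarrow> num_bins n m \<ge> 1"
  by (simp add: num_bins_def div_greater_zero_iff Suc_le_eq)

lemma num_bins_mult_le: "m * num_bins n m \<le> n"
  by (simp add: num_bins_def mult.commute)

lemma bin_edge_le: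
  assumes "k \<in> {1..num_bins n m}"
  shows "m * k \<le> n"
  using assms num_bins_mult_le[of m n] by (meson atLeastAtMost_iff le_trans mult_le_mono2)

lemma bin_cells_subset: "k \<in> {1..num_bins n m} \<Longrightarrow> bin_cells n m k \<subseteq> {1..n}"
  using bin_edge_le[of k n m] by (auto simp: bin_cells_def)

lemma bin_cells_disjoint_less:
  assumes "k \<in> {1..num_bins n m}" "k' \<in> {1..num_bins n m}" "k < k'"
  shows "bin_cells n m k \<inter> bin_cells n m k' = {}"
proof -
  have "m * k \<le> m * (k' - 1)" using assms by (intro mult_le_mono2) auto
  moreover have "i \<le> m * k" if "i \<in> bin_cells n m k" for i
    using assms that by (simp add: bin_cells_def split: if_splits)
  moreover have "m * (k' - 1) < i" if "i \<in> bin_cells n m k'" for i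
    using that by (simp add: bin_cells_def split: if_splits)
  ultimately have "i \<notin> bin_cells n m k \<or> i \<notin> bin_cells n m k'" for i
    by (meson leD le_trans)
  then show ?thesis by blast
qed

lemma bin_cells_disjoint:
  assumes "k \<in> {1..num_bins n m}" "k' \<in> {1..num_bins n m}" "k \<noteq> k'"
  shows "bin_cells n m k \<inter> bin_cells n m k' = {}"
  using bin_cells_disjoint_less[of k n m k'] bin_cells_disjoint_less[of k' n m k] assms
  by (cases "k < k'") auto

lemma bin_cells_cover:
  assumes "0 < m" "m \<le> n"
  shows "(\<Union>k\<in>{1..num_bins n m}. bin_cells n m k) = {1..n}"
proof (intro antisym UN_least bin_cells_subset subsetI)
  fix i assume i: "i \<in> {1..n}"
  define N where "N = num_bins n m"
  have N: "N \<ge> 1" using num_bins_pos assms by (simp add: N_def)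
  show "i \<in> (\<Union>k\<in>{1..num_bins n m}. bin_cells n m k)"
  proof (cases "m * (N - 1) + 1 \<le> i")
    case True
    then have "i \<in> bin_cells n m N" using i by (simp add: bin_cells_def N_def)
    then show ?thesis using N by (auto simp: N_def)
  next
    case False
    define k where "k = (i - 1) div m + 1"
    have "i - 1 < m * (N - 1)" using False i by auto
    then have "(i - 1) div m < N - 1"
      using assms by (simp add: div_less_iff_less_mult mult.commute)
    then have k: "k \<in> {1..N}" "k \<noteq> N" by (auto simp: k_def)
    have "m * (k - 1) \<le> i - 1" by (simp add: k_def)
    moreover have "i - 1 < m * k"
      using dividend_less_times_div[of m "i - 1"] assms by (simp add: k_def algebra_simps)
    ultimately have "i \<in> bin_cells n m k" using i k
      by (auto simp: bin_cells_def N_def[symmetric])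
    then show ?thesis using k by (auto simp: N_def)
  qed
qed

lemma card_bin_cells:
  assumes "0 < m" "k \<in> {1..num_bins n m}"
  shows "m \<le> card (bin_cells n m k)" "card (bin_cells n m k) \<le> 2 * m"
proof -
  have *: "m * (k - 1) + m = m * k" using assms by (cases k) auto
  have "n < m * num_bins n m + m"
    using dividend_less_times_div[of m n] assms by (simp add: num_bins_def algebra_simps)
  with * bin_edge_le[OF assms(2)]
  show "m \<le> card (bin_cells n m k)" "card (bin_cells n m k) \<le> 2 * m"
    by (auto simp: bin_cells_def)
qed

lemma sum_card_bin_cells:
  assumes "0 < m" "m \<le> n"
  shows "(\<Sum>k=1..num_bins n m. card (bin_cells n m k)) = n"
proof -
  have "card (\<Union>k\<in>{1..num_bins n m}. bin_cells n m k) = (\<Sum>k=1..num_bins n m. card (bin_cells n m k))"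
    using bin_cells_disjoint[of _ n m] by (intro card_UN_disjoint) simp_all
  then show ?thesis using bin_cells_cover[OF assms] by simp
qed

lemma bin_disjoint_less:
  assumes "n > 0" "k \<in> {1..num_bins n m}" "k' \<in> {1..num_bins n m}" "k < k'"
  shows "bin n m k \<inter> bin n m k' = {}"
proof -
  have "m * k \<le> m * (k' - 1)" using assms by (intro mult_le_mono2) auto
  then have "real (m * k) / real n \<le> real (m * (k' - 1)) / real n"
    by (intro divide_right_mono) (simp_all only: of_nat_le_iff of_nat_0_le_iff)
  then show ?thesis using assms by (auto simp: bin_def simp del: of_nat_mult)
qed

lemma bin_disjoint:
  assumes "n > 0" "k \<in> {1..num_bins n m}" "k' \<in> {1..num_bins n m}" "k \<noteq> k'"
  shows "bin n m k \<inter> bin n m k' = {}"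
  using bin_disjoint_less[of n k m k'] bin_disjoint_less[of n k' m k] assms
  by (cases "k < k'") auto

lemma bin_measurable [measurable]: "bin n m k \<in> sets borel"
  by (simp add: bin_def)

lemma hist_function_measurable [measurable]: "hist_function n m \<theta> \<in> borel_measurable borel"
  unfolding hist_function_def[abs_def] by measurable

lemma hist_function_eq:
  assumes "n > 0" "k \<in> {1..num_bins n m}" "u \<in> bin n m k"
  shows "hist_function n m \<theta> u = sqrt (\<theta> k)"
proof -
  have "hist_function n m \<theta> u = (\<Sum>j=1..num_bins n m. if j = k then sqrt (\<theta> k) else 0)"
    unfolding hist_function_def
  proof (intro sum.cong refl)
    fix j assume "j \<in> {1..num_bins n m}"
    then show "sqrt (\<theta> j) * indicator (bin n m j) u = (if j = k then sqrt (\<theta> k) else 0)"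
      using bin_disjoint[of n k m j] assms by (auto simp: indicator_def)
  qed
  then show ?thesis using assms by simp
qed

lemma sqrt_power2_abs: "(sqrt x)\<^sup>2 = \<bar>x\<bar>"
  using real_sqrt_abs2[of x] by (metis abs_ge_zero power2_abs real_sqrt_abs' real_sqrt_pow2)

lemma cell_subset_bin:
  assumes "n > 0" "k \<in> {1..num_bins n m}" "i \<in> bin_cells n m k"
  shows "{real (i - 1) / real n ..< real i / real n} \<subseteq> bin n m k"
proof
  fix u assume u: "u \<in> {real (i - 1) / real n ..< real i / real n}"
  have i: "i \<in> {1..n}" using assms bin_cells_subset by blast
  have "m * (k - 1) \<le> i - 1" using assms(3) by (auto simp: bin_cells_def split: if_splits)
  then have 1: "real (m * (k - 1)) / real n \<le> real (i - 1) / real n"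
    by (intro divide_right_mono) (simp_all only: of_nat_le_iff of_nat_0_le_iff)
  show "u \<in> bin n m k"
  proof (cases "k = num_bins n m")
    case True
    have "real i / real n \<le> 1" using i assms(1) by simp
    then show ?thesis using True 1 u by (simp add: bin_def del: of_nat_mult)
  next
    case False
    then have "i \<le> m * k" using assms(3) by (simp add: bin_cells_def)
    then have "real i / real n \<le> real (m * k) / real n"
      by (intro divide_right_mono) (simp_all only: of_nat_le_iff of_nat_0_le_iff)
    then show ?thesis using False 1 u by (simp add: bin_def del: of_nat_mult)
  qed
qed

text \<open>The right end point of a cell may belong to the next bin, so the integrand is constant only up to a
null set.\<close>

lemma cell_integral_hist_function:
  assumes "n > 0" "k \<in> {1..num_bins n m}" "i \<in> bin_cells n m k"
  shows "(LBINT u:{real (i - 1) / real n .. real i / real n}. (hist_function n m \<theta> u)\<^sup>2) = \<bar>\<theta> k\<bar> / real n"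
proof -
  have i: "i \<in> {1..n}" using assms bin_cells_subset by blast
  have eq: "(hist_function n m \<theta> u)\<^sup>2 = \<bar>\<theta> k\<bar>" if "u \<in> {real (i - 1) / real n ..< real i / real n}" for u
    using hist_function_eq[of n k m u \<theta>] cell_subset_bin[OF assms] assms that
    by (auto simp: sqrt_power2_abs)
  have "(LBINT u:{real (i - 1) / real n .. real i / real n}. (hist_function n m \<theta> u)\<^sup>2)
      = (LBINT u:{real (i - 1) / real n .. real i / real n}. \<bar>\<theta> k\<bar>)"
    unfolding set_lebesgue_integral_def
  proof (intro integral_cong_AE)
    show "AE u in lborel. indicator {real (i - 1) / real n..real i / real n} u *\<^sub>R (hist_function n m \<theta> u)\<^sup>2
        = indicator {real (i - 1) / real n..real i / real n} u *\<^sub>R \<bar>\<theta> k\<bar>"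
      using AE_lborel_singleton[of "real i / real n"]
    proof eventually_elim
      case (elim u)
      then show ?case
        using eq[of u] by (cases "u \<in> {real (i - 1) / real n..real i / real n}") auto
    qed
  qed auto
  also have "\<dots> = \<bar>\<theta> k\<bar> / real n"
    using i assms(1) by (simp add: set_integral_const divide_right_mono field_simps of_nat_diff)
  finally show ?thesis .
qed

text \<open>This factorisation over the bins is what makes the coefficients independent under the posterior.\<close>

lemma pseudo_likelihood_hist_function:
  assumes "0 < m" "m \<le> n"
  shows "pseudo_likelihood n x (hist_function n m \<theta>) =
    (\<Prod>k=1..num_bins n m. gauss_block n (bin_cells n m k) (obs_increment n x) (\<theta> k))"
proof -
  have n: "n > 0" using assms by simp
  have "pseudo_likelihood n x (hist_function n m \<theta>) =
    (\<Prod>i\<in>(\<Union>k\<in>{1..num_bins n m}. bin_cells n m k).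
       let v = (LBINT u:{real (i - 1) / real n .. real i / real n}. (hist_function n m \<theta> u)\<^sup>2)
        in 1 / sqrt (2 * pi * v) * exp (- (obs_increment n x i)\<^sup>2 / (2 * v)))"
    unfolding pseudo_likelihood_def bin_cells_cover[OF assms] ..
  also have "\<dots> = (\<Prod>k=1..num_bins n m. \<Prod>i\<in>bin_cells n m k.
       let v = (LBINT u:{real (i - 1) / real n .. real i / real n}. (hist_function n m \<theta> u)\<^sup>2)
        in 1 / sqrt (2 * pi * v) * exp (- (obs_increment n x i)\<^sup>2 / (2 * v)))"
    using bin_cells_disjoint[of _ n m] by (intro prod.UNION_disjoint) simp_all
  also have "\<dots> = (\<Prod>k=1..num_bins n m. gauss_block n (bin_cells n m k) (obs_increment n x) (\<theta> k))"
    unfolding gauss_block_def Let_def using n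
    by (intro prod.cong refl) (simp only: cell_integral_hist_function)
  finally show ?thesis .
qed

lemma bin_cover:
  assumes "0 < m" "m \<le> n" "u \<in> {0..1}"
  obtains k where "k \<in> {1..num_bins n m}" "u \<in> bin n m k"
proof -
  define N where "N = num_bins n m"
  have N: "N \<ge> 1" "N \<in> {1..num_bins n m}" using num_bins_pos assms by (auto simp: N_def)
  show ?thesis
  proof (cases "real (m * (N - 1)) / real n \<le> u")
    case True
    then have "u \<in> bin n m N" using assms by (simp add: bin_def N_def del: of_nat_mult)
    then show ?thesis using that N by blast
  next
    case False
    define i where "i = Suc (nat \<lfloor>real n * u\<rfloor>)"
    have n: "n > 0" using assms by simp
    have nu: "real n * u < real (m * (N - 1))" using False n by (simp add: field_simps del: of_nat_mult)
    have "real (i - 1) \<le> real n * u" "real n * u < real i"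
      using assms by (auto simp: i_def) linarith
    then have u: "u \<in> {real (i - 1) / real n ..< real i / real n}"
      using n by (simp add: field_simps)
    have "real (i - 1) < real (m * (N - 1))" using \<open>real (i - 1) \<le> real n * u\<close> nu by linarith
    then have "i - 1 < m * (N - 1)" by (simp only: of_nat_less_iff)
    moreover have "m * (N - 1) \<le> m * N" by simp
    moreover have "m * N \<le> n" unfolding N_def by (rule num_bins_mult_le)
    moreover have "i \<ge> 1" by (simp add: i_def)
    ultimately have "i \<in> {1..n}" unfolding atLeastAtMost_iff by linarith
    then obtain k where "k \<in> {1..num_bins n m}" "i \<in> bin_cells n m k"
      using bin_cells_cover[OF assms(1,2)] by blast
    then show ?thesis using cell_subset_bin[OF n] u that by blast
  qed
qed

lemma measure_bin:
  assumes "0 < m" "k \<in> {1..num_bins n m}"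
  shows "measure lborel (bin n m k) = real (card (bin_cells n m k)) / real n"
    and "emeasure lborel (bin n m k) < \<infinity>"
proof -
  have n: "n > 0" using assms by (auto simp: num_bins_def intro!: gr0I)
  have le: "m * (k - 1) \<le> m * k" "m * k \<le> n" using bin_edge_le[OF assms(2)] by auto
  then have "m * (k - 1) \<le> n" by (rule le_trans)
  with le have "real (m * (k - 1)) / real n \<le> real (m * k) / real n" "real (m * (k - 1)) / real n \<le> 1"
    using n by (auto simp: divide_right_mono simp del: of_nat_mult)
  then show "measure lborel (bin n m k) = real (card (bin_cells n m k)) / real n"
    using n le by (auto simp: bin_def bin_cells_def diff_divide_distrib of_nat_diff simp del: of_nat_mult)
  have "bounded (bin n m k)"
    by (auto simp: bin_def intro: bounded_subset[OF bounded_closed_interval])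
  then show "emeasure lborel (bin n m k) < \<infinity>"
    using emeasure_bounded_finite by auto
qed

text \<open>On each bin the target \<open>f\<close> is replaced by a constant \<open>a k\<close>, which separates the error of the
coefficients from the oscillation of \<open>f\<close>.\<close>

lemma L2_norm_hist_function_le:
  assumes m: "0 < m" "m \<le> n"
    and osc: "\<And>k u. k \<in> {1..num_bins n m} \<Longrightarrow> u \<in> bin n m k \<Longrightarrow> \<bar>f u - a k\<bar> \<le> \<eta>"
  shows "(L2_norm_01 (\<lambda>u. (hist_function n m \<theta> u)\<^sup>2 - f u))\<^sup>2
    \<le> (\<Sum>k=1..num_bins n m. real (card (bin_cells n m k)) / real n * (2 * (\<bar>\<theta> k\<bar> - a k)\<^sup>2 + 2 * \<eta>\<^sup>2))"
proof -
  define c where "c k = 2 * (\<bar>\<theta> k\<bar> - a k)\<^sup>2 + 2 * \<eta>\<^sup>2" for k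
  have n: "n > 0" using m by simp
  have c: "c k \<ge> 0" for k by (simp add: c_def)
  have int: "integrable lborel (\<lambda>u. c k * indicator (bin n m k) u)" if "k \<in> {1..num_bins n m}" for k
    using measure_bin(2)[OF m(1) that]
    by (intro integrable_mult_right integrable_real_indicator) auto
  have "(L2_norm_01 (\<lambda>u. (hist_function n m \<theta> u)\<^sup>2 - f u))\<^sup>2
      = (LBINT u:{0..1}. ((hist_function n m \<theta> u)\<^sup>2 - f u)\<^sup>2)"
    unfolding L2_norm_01_def by (intro real_sqrt_pow2) (simp add: set_lebesgue_integral_def)
  also have "\<dots> \<le> (\<integral>u. (\<Sum>k=1..num_bins n m. c k * indicator (bin n m k) u) \<partial>lborel)"
    unfolding set_lebesgue_integral_def
  proof (intro integral_mono')
    fix u :: real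
    show nn: "0 \<le> (\<Sum>k=1..num_bins n m. c k * indicator (bin n m k) u)"
      using c by (intro sum_nonneg) auto
    show "indicator {0..1} u *\<^sub>R ((hist_function n m \<theta> u)\<^sup>2 - f u)\<^sup>2
        \<le> (\<Sum>k=1..num_bins n m. c k * indicator (bin n m k) u)"
    proof (cases "u \<in> {0..1}")
      case True
      then obtain k where k: "k \<in> {1..num_bins n m}" "u \<in> bin n m k"
        using bin_cover m by blast
      have "((hist_function n m \<theta> u)\<^sup>2 - f u)\<^sup>2 = ((\<bar>\<theta> k\<bar> - a k) - (f u - a k))\<^sup>2"
        using hist_function_eq[OF n k] by (simp add: sqrt_power2_abs)
      also have "\<dots> \<le> 2 * (\<bar>\<theta> k\<bar> - a k)\<^sup>2 + 2 * (f u - a k)\<^sup>2"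
        using zero_le_power2[of "(\<bar>\<theta> k\<bar> - a k) + (f u - a k)"] by (simp add: power2_eq_square algebra_simps)
      also have "(f u - a k)\<^sup>2 \<le> \<eta>\<^sup>2"
        using osc[OF k] by (simp add: abs_le_square_iff[symmetric])
      finally have "((hist_function n m \<theta> u)\<^sup>2 - f u)\<^sup>2 \<le> c k * indicator (bin n m k) u"
        using k by (simp add: c_def)
      also have "\<dots> \<le> (\<Sum>k=1..num_bins n m. c k * indicator (bin n m k) u)"
        using k c by (intro member_le_sum) auto
      finally show ?thesis using True by simp
    qed (use nn in simp)
  qed (intro Bochner_Integration.integrable_sum int)
  also have "\<dots> = (\<Sum>k=1..num_bins n m. c k * measure lborel (bin n m k))"
    using int by (subst Bochner_Integration.integral_sum) auto
  also have "\<dots> = (\<Sum>k=1..num_bins n m. real (card (bin_cells n m k)) / real n * c k)"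
    using m by (intro sum.cong) (auto simp: measure_bin)
  finally show ?thesis by (simp add: c_def)
qed

section \<open>The posterior mass outside an L2 ball\<close>

text \<open>The Bochner integral of a non-integrable function is \<open>0\<close>, so a pointwise bound by a nonnegative
integrable function is enough. It serves to bound the integral of the indicator of
a set of parameters whose measurability is left open.\<close>

lemma integral_le_of_dominated:
  fixes f g :: "'a \<Rightarrow> real"
  assumes "has_bochner_integral M g I" "\<And>x. f x \<le> g x" "\<And>x. 0 \<le> g x"
  shows "integral\<^sup>L M f \<le> I"
  using integral_mono'[of M g f] assms by (simp add: has_bochner_integral_iff)

text \<open>Markov's inequality for the posterior. Since prior and likelihood are products, replacing the \<open>k\<close>-th
factor by \<open>(\<bar>\<theta> k\<bar> - a k)\<^sup>2\<close> times itself multiplies the evidence by the risk of the \<open>k\<close>-th bin, so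
the posterior expected loss is a weighted sum of bin risks.\<close>

lemma posterior_histogram_bounds:
  fixes x a :: "_ \<Rightarrow> real" and \<alpha> \<beta> :: real
  assumes m: "4 \<le> m" "m \<le> n" and pos: "\<alpha> > 0" "\<beta> > 0" and r: "r > 0"
    and osc: "\<And>k u. k \<in> {1..num_bins n m} \<Longrightarrow> u \<in> bin n m k \<Longrightarrow> \<bar>f u - a k\<bar> \<le> \<eta>"
  defines "w \<equiv> \<lambda>k. card (bin_cells n m k)"
    and "S \<equiv> {s. L2_norm_01 (\<lambda>u. (s u)\<^sup>2 - f u) \<ge> r}"
  shows "0 \<le> posterior \<alpha> \<beta> n m x S" and "posterior \<alpha> \<beta> n m x S \<le> 1"
    and "posterior \<alpha> \<beta> n m x S \<le> (\<Sum>k=1..num_bins n m. real (w k) / real n *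
       (2 * posterior_bin_risk \<alpha> \<beta> n (bin_cells n m k) (obs_increment n x) (a k) + 2 * \<eta>\<^sup>2)) / r\<^sup>2"
proof -
  define N where "N = num_bins n m"
  define P where "P = coeff_prior \<alpha> \<beta> n m"
  define g where "g k = gauss_block n (bin_cells n m k) (obs_increment n x)" for k
  define lik where "lik \<theta> = pseudo_likelihood n x (hist_function n m \<theta>)" for \<theta>
  define R where "R k = posterior_bin_risk \<alpha> \<beta> n (bin_cells n m k) (obs_increment n x) (a k)" for k
  have m0: "0 < m" and n: "n > 0" using m by auto
  have lik_eq: "lik \<theta> = (\<Prod>k=1..N. g k (\<theta> k))" for \<theta>
    unfolding lik_def N_def g_def by (rule pseudo_likelihood_hist_function[OF m0 m(2)])
  have g_nonneg: "g k t \<ge> 0" for k t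
    unfolding g_def gauss_block_def by (intro prod_nonneg) auto
  have lik_nonneg: "lik \<theta> \<ge> 0" for \<theta>
    unfolding lik_eq by (intro prod_nonneg g_nonneg)
  have "\<forall>k\<in>{1..N}. \<exists>D. D > 0 \<and> has_bochner_integral (inverse_gamma \<alpha> \<beta>) (g k) D \<and>
      has_bochner_integral (inverse_gamma \<alpha> \<beta>) (\<lambda>\<theta>. (\<bar>\<theta>\<bar> - a k)\<^sup>2 * g k \<theta>) (D * R k)"
  proof
    fix k assume "k \<in> {1..N}"
    then have card: "card (bin_cells n m k) \<ge> 4"
      using card_bin_cells(1)[OF m0, of k n] m by (simp add: N_def)
    have "\<exists>D>0. has_bochner_integral (inverse_gamma \<alpha> \<beta>) (g k) D \<and>
      (\<forall>c. has_bochner_integral (inverse_gamma \<alpha> \<beta>) (\<lambda>\<theta>. (\<bar>\<theta>\<bar> - c)\<^sup>2 * g k \<theta>)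
        (D * posterior_bin_risk \<alpha> \<beta> n (bin_cells n m k) (obs_increment n x) c))"
      unfolding g_def by (rule bin_posterior[OF n finite_bin_cells pos card])
    then show "\<exists>D. D > 0 \<and> has_bochner_integral (inverse_gamma \<alpha> \<beta>) (g k) D \<and>
      has_bochner_integral (inverse_gamma \<alpha> \<beta>) (\<lambda>\<theta>. (\<bar>\<theta>\<bar> - a k)\<^sup>2 * g k \<theta>) (D * R k)"
      unfolding R_def by blast
  qed
  from bchoice[OF this] obtain D where D': "\<forall>k\<in>{1..N}. D k > 0 \<and>
      has_bochner_integral (inverse_gamma \<alpha> \<beta>) (g k) (D k) \<and>
      has_bochner_integral (inverse_gamma \<alpha> \<beta>) (\<lambda>\<theta>. (\<bar>\<theta>\<bar> - a k)\<^sup>2 * g k \<theta>) (D k * R k)"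
    by blast
  have D: "D k > 0"
    and int_g: "has_bochner_integral (inverse_gamma \<alpha> \<beta>) (g k) (D k)"
    and int_sq: "has_bochner_integral (inverse_gamma \<alpha> \<beta>) (\<lambda>\<theta>. (\<bar>\<theta>\<bar> - a k)\<^sup>2 * g k \<theta>) (D k * R k)"
    if "k \<in> {1..N}" for k
    using D' that by auto
  interpret product_sigma_finite "\<lambda>_ :: nat. inverse_gamma \<alpha> \<beta>"
    by (simp add: product_sigma_finite_def sigma_finite_inverse_gamma)
  have P_eq: "P = PiM {1..N} (\<lambda>_. inverse_gamma \<alpha> \<beta>)" by (simp add: P_def coeff_prior_def N_def)
  have int_prod: "has_bochner_integral P (\<lambda>\<theta>. \<Prod>k=1..N. h k (\<theta> k)) (\<Prod>k=1..N. I k)"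
    if "\<And>k. k \<in> {1..N} \<Longrightarrow> has_bochner_integral (inverse_gamma \<alpha> \<beta>) (h k) (I k)"
    for h :: "nat \<Rightarrow> real \<Rightarrow> real" and I
    unfolding P_eq has_bochner_integral_iff
    using that product_integrable_prod[of "{1..N}" h] product_integral_prod[of "{1..N}" h]
    by (simp add: has_bochner_integral_iff)
  define Z where "Z = (\<Prod>k=1..N. D k)"
  have Z: "Z > 0" unfolding Z_def using D by (intro prod_pos) auto
  have int_lik: "has_bochner_integral P lik Z"
    unfolding lik_eq[abs_def] Z_def by (rule int_prod) (rule int_g)
  have int_sq_lik: "has_bochner_integral P (\<lambda>\<theta>. (\<bar>\<theta> k\<bar> - a k)\<^sup>2 * lik \<theta>) (R k * Z)"
    if k: "k \<in> {1..N}" for k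
  proof -
    have "has_bochner_integral P
        (\<lambda>\<theta>. \<Prod>j=1..N. (if j = k then (\<bar>\<theta> j\<bar> - a k)\<^sup>2 * g j (\<theta> j) else g j (\<theta> j)))
        (\<Prod>j=1..N. if j = k then D j * R k else D j)"
      using int_g int_sq by (intro int_prod) auto
    moreover have "(\<Prod>j=1..N. (if j = k then (\<bar>\<theta> j\<bar> - a k)\<^sup>2 * g j (\<theta> j) else g j (\<theta> j)))
        = (\<bar>\<theta> k\<bar> - a k)\<^sup>2 * lik \<theta>" for \<theta>
      unfolding lik_eq using k by (simp add: prod.remove[of _ k])
    moreover have "(\<Prod>j=1..N. if j = k then D j * R k else D j) = R k * Z"
      unfolding Z_def using k by (simp add: prod.remove[of _ k])
    ultimately show ?thesis by simp
  qed
  \<comment> \<open>The bound of \<open>L2_norm_hist_function_le\<close> for the squared distance.\<close>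
  define loss where "loss \<theta> = (\<Sum>k=1..N. real (w k) / real n * (2 * (\<bar>\<theta> k\<bar> - a k)\<^sup>2 + 2 * \<eta>\<^sup>2))"
    for \<theta> :: "nat \<Rightarrow> real"
  have loss_nonneg: "loss \<theta> \<ge> 0" for \<theta>
    unfolding loss_def by (intro sum_nonneg mult_nonneg_nonneg) auto
  have "has_bochner_integral P (\<lambda>\<theta>. (\<Sum>k=1..N. real (w k) / real n *
        (2 * ((\<bar>\<theta> k\<bar> - a k)\<^sup>2 * lik \<theta>) + 2 * \<eta>\<^sup>2 * lik \<theta>)) / r\<^sup>2)
      ((\<Sum>k=1..N. real (w k) / real n * (2 * (R k * Z) + 2 * \<eta>\<^sup>2 * Z)) / r\<^sup>2)"
    by (intro has_bochner_integral_divide_zero has_bochner_integral_sum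
        has_bochner_integral_mult_right has_bochner_integral_add int_sq_lik int_lik) auto
  also have "(\<lambda>\<theta>. (\<Sum>k=1..N. real (w k) / real n *
        (2 * ((\<bar>\<theta> k\<bar> - a k)\<^sup>2 * lik \<theta>) + 2 * \<eta>\<^sup>2 * lik \<theta>)) / r\<^sup>2) = (\<lambda>\<theta>. loss \<theta> / r\<^sup>2 * lik \<theta>)"
    unfolding loss_def by (simp add: sum_distrib_left algebra_simps)
  also have "(\<Sum>k=1..N. real (w k) / real n * (2 * (R k * Z) + 2 * \<eta>\<^sup>2 * Z)) / r\<^sup>2
      = (\<Sum>k=1..N. real (w k) / real n * (2 * R k + 2 * \<eta>\<^sup>2)) / r\<^sup>2 * Z"
    by (simp add: sum_distrib_left sum_distrib_right algebra_simps)
  finally have int_loss: "has_bochner_integral P (\<lambda>\<theta>. loss \<theta> / r\<^sup>2 * lik \<theta>)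
      ((\<Sum>k=1..N. real (w k) / real n * (2 * R k + 2 * \<eta>\<^sup>2)) / r\<^sup>2 * Z)" .
  define num where "num = (\<integral>\<theta>. indicator S (hist_function n m \<theta>) * lik \<theta> \<partial>P)"
  have post: "posterior \<alpha> \<beta> n m x S = num / Z"
    unfolding posterior_def num_def lik_def[symmetric] P_def[symmetric]
    using int_lik by (simp add: has_bochner_integral_iff)
  have markov: "indicator S (hist_function n m \<theta>) \<le> loss \<theta> / r\<^sup>2" for \<theta>
  proof (cases "hist_function n m \<theta> \<in> S")
    case True
    then have "r\<^sup>2 \<le> (L2_norm_01 (\<lambda>u. (hist_function n m \<theta> u)\<^sup>2 - f u))\<^sup>2"
      using r by (intro power_mono) (auto simp: S_def)
    also have "\<dots> \<le> loss \<theta>"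
      unfolding loss_def w_def N_def by (rule L2_norm_hist_function_le[OF m0 m(2) osc])
    finally show ?thesis using r True by simp
  qed (use loss_nonneg in simp)
  have "num \<ge> 0" unfolding num_def by (intro Bochner_Integration.integral_nonneg) (simp add: lik_nonneg)
  then show "0 \<le> posterior \<alpha> \<beta> n m x S" using Z by (simp add: post)
  have "num \<le> Z" unfolding num_def
    by (rule integral_le_of_dominated[OF int_lik])
      (auto simp: lik_nonneg indicator_def)
  then show "posterior \<alpha> \<beta> n m x S \<le> 1" using Z by (simp add: post)
  have "num \<le> (\<Sum>k=1..N. real (w k) / real n * (2 * R k + 2 * \<eta>\<^sup>2)) / r\<^sup>2 * Z"
    unfolding num_def
  proof (rule integral_le_of_dominated[OF int_loss])
    fix \<theta>
    show "indicator S (hist_function n m \<theta>) * lik \<theta> \<le> loss \<theta> / r\<^sup>2 * lik \<theta>"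
      by (intro mult_right_mono markov lik_nonneg)
    show "0 \<le> loss \<theta> / r\<^sup>2 * lik \<theta>" by (simp add: loss_nonneg lik_nonneg)
  qed
  then show "posterior \<alpha> \<beta> n m x S \<le> (\<Sum>k=1..num_bins n m. real (w k) / real n *
       (2 * posterior_bin_risk \<alpha> \<beta> n (bin_cells n m k) (obs_increment n x) (a k) + 2 * \<eta>\<^sup>2)) / r\<^sup>2"
    using Z unfolding post R_def N_def by (simp add: pos_divide_le_eq)
qed

section \<open>Sums of squares of independent normal variables\<close>

lemma (in prob_space) normal_second_moment:
  assumes "distributed M lborel X (normal_density 0 \<sigma>)" "\<sigma> > 0"
  shows "has_bochner_integral M (\<lambda>\<omega>. (X \<omega>)\<^sup>2) (\<sigma>\<^sup>2)"
  using normal_moment_even[of \<sigma> 0 1] distributed_integral[OF assms(1), of "\<lambda>x. x\<^sup>2"]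
    distributed_integrable[OF assms(1), of "\<lambda>x. x\<^sup>2"] assms(2)
  by (simp add: has_bochner_integral_iff power_divide)

lemma (in prob_space) normal_fourth_moment:
  assumes "distributed M lborel X (normal_density 0 \<sigma>)" "\<sigma> > 0"
  shows "has_bochner_integral M (\<lambda>\<omega>. (X \<omega>) ^ 4) (3 * \<sigma> ^ 4)"
  using normal_moment_even[of \<sigma> 0 2] distributed_integral[OF assms(1), of "\<lambda>x. x ^ 4"]
    distributed_integrable[OF assms(1), of "\<lambda>x. x ^ 4"] assms(2)
  by (simp add: has_bochner_integral_iff fact_numeral power_divide)

text \<open>Variance plus squared bias of a sum of squares about an arbitrary centre \<open>c\<close>: the centred squares
\<open>G i\<^sup>2 - \<sigma> i\<^sup>2\<close> are uncorrelated with variance \<open>3 \<sigma>\<^sup>4 - \<sigma>\<^sup>4 = 2 \<sigma>\<^sup>4\<close>.\<close>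

lemma (in prob_space) second_moment_sum_squares_indep_normal:
  assumes fin: "finite I" and ind: "indep_vars (\<lambda>_. borel) G I"
    and norm: "\<And>i. i \<in> I \<Longrightarrow> distributed M lborel (G i) (normal_density 0 (\<sigma> i))"
    and pos: "\<And>i. i \<in> I \<Longrightarrow> \<sigma> i > 0"
  shows "has_bochner_integral M (\<lambda>\<omega>. ((\<Sum>i\<in>I. (G i \<omega>)\<^sup>2) - c)\<^sup>2)
    (2 * (\<Sum>i\<in>I. (\<sigma> i) ^ 4) + ((\<Sum>i\<in>I. (\<sigma> i)\<^sup>2) - c)\<^sup>2)"
proof -
  define H where "H i \<omega> = (G i \<omega>)\<^sup>2 - (\<sigma> i)\<^sup>2" for i \<omega>
  define d where "d = (\<Sum>i\<in>I. (\<sigma> i)\<^sup>2) - c"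
  have one: "has_bochner_integral M (\<lambda>_. x) x" for x :: real
    by (simp add: has_bochner_integral_iff prob_space)
  have H: "has_bochner_integral M (H i) 0" if "i \<in> I" for i
    using has_bochner_integral_diff[OF normal_second_moment[OF norm[OF that] pos[OF that]] one[of "(\<sigma> i)\<^sup>2"]]
    unfolding H_def[abs_def] by simp
  have HH: "has_bochner_integral M (\<lambda>\<omega>. H i \<omega> * H j \<omega>) (if i = j then 2 * (\<sigma> i) ^ 4 else 0)"
    if ij: "i \<in> I" "j \<in> I" for i j
  proof (cases "i = j")
    case True
    have "has_bochner_integral M (\<lambda>\<omega>. (G i \<omega>) ^ 4 - 2 * (\<sigma> i)\<^sup>2 * (G i \<omega>)\<^sup>2 + (\<sigma> i) ^ 4)
        (3 * (\<sigma> i) ^ 4 - 2 * (\<sigma> i)\<^sup>2 * (\<sigma> i)\<^sup>2 + (\<sigma> i) ^ 4)"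
      using ij by (intro has_bochner_integral_add has_bochner_integral_diff has_bochner_integral_mult_right
          one normal_second_moment normal_fourth_moment norm pos)
    moreover have "(G i \<omega>) ^ 4 - 2 * (\<sigma> i)\<^sup>2 * (G i \<omega>)\<^sup>2 + (\<sigma> i) ^ 4 = H i \<omega> * H j \<omega>" for \<omega>
      using True by (simp add: H_def power2_eq_square power4_eq_xxxx algebra_simps)
    ultimately show ?thesis using True by (simp add: power2_eq_square power4_eq_xxxx algebra_simps)
  next
    case False
    have ind2: "indep_vars (\<lambda>_. borel) H {i, j}"
      using indep_vars_compose2[OF indep_vars_subset[OF ind, of "{i, j}"], of "\<lambda>i x. x\<^sup>2 - (\<sigma> i)\<^sup>2" "\<lambda>_. borel"] ij
      by (simp add: H_def[abs_def])
    have "(\<integral>\<omega>. (\<Prod>l\<in>{i, j}. H l \<omega>) \<partial>M) = (\<Prod>l\<in>{i, j}. \<integral>\<omega>. H l \<omega> \<partial>M)"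
      and "integrable M (\<lambda>\<omega>. \<Prod>l\<in>{i, j}. H l \<omega>)"
      using H ij by (intro indep_vars_lebesgue_integral indep_vars_integrable ind2;
          auto simp: has_bochner_integral_iff)+
    then show ?thesis using False H ij by (simp add: has_bochner_integral_iff)
  qed
  have "has_bochner_integral M (\<lambda>\<omega>. (\<Sum>i\<in>I. \<Sum>j\<in>I. H i \<omega> * H j \<omega>) + 2 * d * (\<Sum>i\<in>I. H i \<omega>) + d\<^sup>2)
      ((\<Sum>i\<in>I. \<Sum>j\<in>I. if i = j then 2 * (\<sigma> i) ^ 4 else 0) + 2 * d * (\<Sum>i\<in>I. 0) + d\<^sup>2)"
    by (intro has_bochner_integral_add has_bochner_integral_mult_right has_bochner_integral_sum one H HH)
  moreover have "(\<Sum>i\<in>I. \<Sum>j\<in>I. H i \<omega> * H j \<omega>) + 2 * d * (\<Sum>i\<in>I. H i \<omega>) + d\<^sup>2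
      = ((\<Sum>i\<in>I. (G i \<omega>)\<^sup>2) - c)\<^sup>2" for \<omega>
  proof -
    have "(\<Sum>i\<in>I. (G i \<omega>)\<^sup>2) - c = (\<Sum>i\<in>I. H i \<omega>) + d"
      by (simp add: H_def d_def sum_subtractf)
    then show ?thesis
      by (simp add: sum_product[symmetric] power2_eq_square algebra_simps)
  qed
  ultimately show ?thesis using fin by (simp add: d_def sum_distrib_left)
qed

section \<open>Brownian motion and the isometry for step functions\<close>

locale brownian = prob_space M for M :: "'w measure" +
  fixes W :: "real \<Rightarrow> 'w \<Rightarrow> real"
  assumes BM: "standard_Brownian_motion M W"
begin

lemma W_measurable: "t \<in> {0..1} \<Longrightarrow> W t \<in> borel_measurable M"
  using BM by (simp add: standard_Brownian_motion_def)

lemma increment_normal: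
  "0 \<le> u \<Longrightarrow> u < t \<Longrightarrow> t \<le> 1 \<Longrightarrow>
    distributed M lborel (\<lambda>\<omega>. W t \<omega> - W u \<omega>) (normal_density 0 (sqrt (t - u)))"
  using BM by (simp add: standard_Brownian_motion_def)

lemma increment_indep:
  "(\<And>i. i \<le> k \<Longrightarrow> p i \<in> {0..1}) \<Longrightarrow> (\<And>i. i < k \<Longrightarrow> p i < p (Suc i)) \<Longrightarrow>
    indep_vars (\<lambda>_. borel) (\<lambda>i \<omega>. W (p (Suc i)) \<omega> - W (p i) \<omega>) {..<k}"
  using BM unfolding standard_Brownian_motion_def by blast

lemma increment_second_moment:
  assumes "s \<in> {0..1}" "t \<in> {0..1}"
  shows "has_bochner_integral M (\<lambda>\<omega>. (W s \<omega> - W t \<omega>)\<^sup>2) \<bar>s - t\<bar>"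
proof -
  have *: "has_bochner_integral M (\<lambda>\<omega>. (W t \<omega> - W s \<omega>)\<^sup>2) (t - s)"
    if "s < t" "s \<in> {0..1}" "t \<in> {0..1}" for s t
    using normal_second_moment[OF increment_normal[of s t]] that by simp
  consider "s < t" | "t < s" | "s = t" by linarith
  then show ?thesis
  proof cases
    case 1 then show ?thesis using *[of s t] assms by (simp add: power2_commute)
  next
    case 2 then show ?thesis using *[of t s] assms by simp
  next
    case 3 then show ?thesis by (simp add: has_bochner_integral_zero)
  qed
qed

text \<open>Polarisation: the covariance is determined by the second moments of the increments.\<close>

lemma brownian_covariance:
  assumes "s \<in> {0..1}" "t \<in> {0..1}"
  shows "has_bochner_integral M (\<lambda>\<omega>. (W s \<omega> - W 0 \<omega>) * (W t \<omega> - W 0 \<omega>)) (min s t)"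
proof -
  have "has_bochner_integral M (\<lambda>\<omega>. ((W s \<omega> - W 0 \<omega>)\<^sup>2 + (W t \<omega> - W 0 \<omega>)\<^sup>2 - (W s \<omega> - W t \<omega>)\<^sup>2) / 2)
      ((\<bar>s - 0\<bar> + \<bar>t - 0\<bar> - \<bar>s - t\<bar>) / 2)"
    using assms by (intro has_bochner_integral_divide_zero has_bochner_integral_add
        has_bochner_integral_diff increment_second_moment) auto
  moreover have "((W s \<omega> - W 0 \<omega>)\<^sup>2 + (W t \<omega> - W 0 \<omega>)\<^sup>2 - (W s \<omega> - W t \<omega>)\<^sup>2) / 2
      = (W s \<omega> - W 0 \<omega>) * (W t \<omega> - W 0 \<omega>)" for \<omega>
    by (simp add: power2_eq_square field_simps)
  moreover have "(\<bar>s - 0\<bar> + \<bar>t - 0\<bar> - \<bar>s - t\<bar>) / 2 = min s t"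
    using assms by (auto simp: min_def)
  ultimately show ?thesis by (simp only:)
qed

lemma increment_covariance:
  assumes "a \<in> {0..1}" "b \<in> {0..1}" "c \<in> {0..1}" "d \<in> {0..1}" "a \<le> b" "c \<le> d"
  shows "has_bochner_integral M (\<lambda>\<omega>. (W b \<omega> - W a \<omega>) * (W d \<omega> - W c \<omega>))
     (measure lborel ({a<..b} \<inter> {c<..d}))"
proof -
  have "has_bochner_integral M (\<lambda>\<omega>. (W b \<omega> - W 0 \<omega>) * (W d \<omega> - W 0 \<omega>) - (W b \<omega> - W 0 \<omega>) * (W c \<omega> - W 0 \<omega>)
      - (W a \<omega> - W 0 \<omega>) * (W d \<omega> - W 0 \<omega>) + (W a \<omega> - W 0 \<omega>) * (W c \<omega> - W 0 \<omega>))
      (min b d - min b c - min a d + min a c)"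
    using assms by (intro has_bochner_integral_add has_bochner_integral_diff brownian_covariance)
  moreover have "min b d - min b c - min a d + min a c = measure lborel ({a<..b} \<inter> {c<..d})"
  proof -
    have "{a<..b} \<inter> {c<..d} = {max a c<..min b d}" by auto
    then show ?thesis using assms by (auto simp: min_def max_def measure_def)
  qed
  moreover have "(W b \<omega> - W 0 \<omega>) * (W d \<omega> - W 0 \<omega>) - (W b \<omega> - W 0 \<omega>) * (W c \<omega> - W 0 \<omega>)
      - (W a \<omega> - W 0 \<omega>) * (W d \<omega> - W 0 \<omega>) + (W a \<omega> - W 0 \<omega>) * (W c \<omega> - W 0 \<omega>)
      = (W b \<omega> - W a \<omega>) * (W d \<omega> - W c \<omega>)" for \<omega>
    by (simp add: algebra_simps)
  ultimately show ?thesis by simp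
qed

definition unit_partition :: "nat \<Rightarrow> (nat \<Rightarrow> real) \<Rightarrow> bool" where
  "unit_partition k p \<longleftrightarrow> (\<forall>i\<le>k. p i \<in> {0..1}) \<and> (\<forall>i<k. p i \<le> p (Suc i))"

text \<open>Both bilinear forms are sums over pairs of intervals of the length of the overlap. In this form
the two step functions may live on unrelated partitions.\<close>

lemma step_integral_covariance:
  assumes p: "unit_partition k p" and q: "unit_partition l q"
  shows "has_bochner_integral M (\<lambda>\<omega>. step_integral W k p c \<omega> * step_integral W l q d \<omega>)
      (\<Sum>i<k. \<Sum>j<l. c i * d j * measure lborel ({p i<..p (Suc i)} \<inter> {q j<..q (Suc j)}))"
    and "has_bochner_integral lborel (\<lambda>u. step_function k p c u * step_function l q d u)
      (\<Sum>i<k. \<Sum>j<l. c i * d j * measure lborel ({p i<..p (Suc i)} \<inter> {q j<..q (Suc j)}))"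
proof -
  have "has_bochner_integral M (\<lambda>\<omega>. \<Sum>i<k. \<Sum>j<l. c i * d j *
        ((W (p (Suc i)) \<omega> - W (p i) \<omega>) * (W (q (Suc j)) \<omega> - W (q j) \<omega>)))
      (\<Sum>i<k. \<Sum>j<l. c i * d j * measure lborel ({p i<..p (Suc i)} \<inter> {q j<..q (Suc j)}))"
    using p q unfolding unit_partition_def
    by (intro has_bochner_integral_sum has_bochner_integral_mult_right increment_covariance) auto
  then show "has_bochner_integral M (\<lambda>\<omega>. step_integral W k p c \<omega> * step_integral W l q d \<omega>)
      (\<Sum>i<k. \<Sum>j<l. c i * d j * measure lborel ({p i<..p (Suc i)} \<inter> {q j<..q (Suc j)}))"
    by (simp add: step_integral_def sum_product mult_ac)
  have "has_bochner_integral lborel (\<lambda>u. \<Sum>i<k. \<Sum>j<l. c i * d j *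
        indicator ({p i<..p (Suc i)} \<inter> {q j<..q (Suc j)}) u)
      (\<Sum>i<k. \<Sum>j<l. c i * d j * measure lborel ({p i<..p (Suc i)} \<inter> {q j<..q (Suc j)}))"
  proof (intro has_bochner_integral_sum has_bochner_integral_mult_right has_bochner_integral_real_indicator)
    show "emeasure lborel ({p i<..p (Suc i)} \<inter> {q j<..q (Suc j)}) < \<infinity>" for i j
      using emeasure_bounded_finite[of "{p i<..p (Suc i)} \<inter> {q j<..q (Suc j)}"]
      by (auto intro: bounded_subset[OF bounded_closed_interval, of _ "p i" "p (Suc i)"])
  qed auto
  moreover have "(\<Sum>i<k. \<Sum>j<l. c i * d j * indicator ({p i<..p (Suc i)} \<inter> {q j<..q (Suc j)}) u)
      = step_function k p c u * step_function l q d u" for u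
    unfolding step_function_def sum_product by (intro sum.cong refl) (simp add: indicator_def)
  ultimately show "has_bochner_integral lborel (\<lambda>u. step_function k p c u * step_function l q d u)
      (\<Sum>i<k. \<Sum>j<l. c i * d j * measure lborel ({p i<..p (Suc i)} \<inter> {q j<..q (Suc j)}))"
    by simp
qed

lemma step_integral_isometry:
  assumes p: "unit_partition k p" and q: "unit_partition l q"
  shows "(\<integral>\<^sup>+\<omega>. ennreal ((step_integral W k p c \<omega> - step_integral W l q d \<omega>)\<^sup>2) \<partial>M)
    = (\<integral>\<^sup>+u. ennreal ((step_function k p c u - step_function l q d u)\<^sup>2) \<partial>lborel)"
proof -
  define I11 I12 I22 where
    "I11 = (\<Sum>i<k. \<Sum>j<k. c i * c j * measure lborel ({p i<..p (Suc i)} \<inter> {p j<..p (Suc j)}))" and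
    "I12 = (\<Sum>i<k. \<Sum>j<l. c i * d j * measure lborel ({p i<..p (Suc i)} \<inter> {q j<..q (Suc j)}))" and
    "I22 = (\<Sum>i<l. \<Sum>j<l. d i * d j * measure lborel ({q i<..q (Suc i)} \<inter> {q j<..q (Suc j)}))"
  note cov = step_integral_covariance[OF p p, of c c, folded I11_def]
    step_integral_covariance[OF p q, of c d, folded I12_def]
    step_integral_covariance[OF q q, of d d, folded I22_def]
  have sq: "(x - y)\<^sup>2 = x * x - 2 * (x * y) + y * y" for x y :: real
    by (simp add: power2_eq_square algebra_simps)
  have "has_bochner_integral M (\<lambda>\<omega>. (step_integral W k p c \<omega> - step_integral W l q d \<omega>)\<^sup>2) (I11 - 2 * I12 + I22)"
    unfolding sq by (intro has_bochner_integral_add has_bochner_integral_diff has_bochner_integral_mult_right cov)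
  moreover have "has_bochner_integral lborel (\<lambda>u. (step_function k p c u - step_function l q d u)\<^sup>2) (I11 - 2 * I12 + I22)"
    unfolding sq by (intro has_bochner_integral_add has_bochner_integral_diff has_bochner_integral_mult_right cov)
  ultimately show ?thesis
    by (simp add: has_bochner_integral_iff nn_integral_eq_integral)
qed

end

section \<open>Riemann sums for Wiener integrals\<close>

lemma nn_integral_sq_dist_triangle:
  fixes f g h :: "'a \<Rightarrow> real"
  assumes [measurable]: "f \<in> borel_measurable M" "g \<in> borel_measurable M" "h \<in> borel_measurable M"
  shows "(\<integral>\<^sup>+x. ennreal ((f x - h x)\<^sup>2) \<partial>M)
    \<le> 2 * (\<integral>\<^sup>+x. ennreal ((f x - g x)\<^sup>2) \<partial>M) + 2 * (\<integral>\<^sup>+x. ennreal ((g x - h x)\<^sup>2) \<partial>M)"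
proof -
  have "ennreal ((f x - h x)\<^sup>2) \<le> 2 * ennreal ((f x - g x)\<^sup>2) + 2 * ennreal ((g x - h x)\<^sup>2)" for x
  proof -
    have "(f x - h x)\<^sup>2 \<le> 2 * (f x - g x)\<^sup>2 + 2 * (g x - h x)\<^sup>2"
      using zero_le_power2[of "f x - 2 * g x + h x"] by (simp add: power2_eq_square algebra_simps)
    then have "ennreal ((f x - h x)\<^sup>2) \<le> ennreal (2 * (f x - g x)\<^sup>2 + 2 * (g x - h x)\<^sup>2)"
      by (rule ennreal_leI)
    then show ?thesis by (simp add: ennreal_plus ennreal_mult)
  qed
  then have "(\<integral>\<^sup>+x. ennreal ((f x - h x)\<^sup>2) \<partial>M)
      \<le> (\<integral>\<^sup>+x. 2 * ennreal ((f x - g x)\<^sup>2) + 2 * ennreal ((g x - h x)\<^sup>2) \<partial>M)"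
    by (intro nn_integral_mono)
  also have "\<dots> = 2 * (\<integral>\<^sup>+x. ennreal ((f x - g x)\<^sup>2) \<partial>M) + 2 * (\<integral>\<^sup>+x. ennreal ((g x - h x)\<^sup>2) \<partial>M)"
    by (simp add: nn_integral_add nn_integral_cmult)
  finally show ?thesis .
qed

lemma step_function_measurable [measurable]: "step_function k p c \<in> borel_measurable borel"
  unfolding step_function_def[abs_def] by measurable

lemma step_function_grid_eq:
  assumes "N > 0" "i < k" "u \<in> {real i / real N<..real (Suc i) / real N}"
  shows "step_function k (\<lambda>i. real i / real N) c u = c i"
proof -
  have "step_function k (\<lambda>i. real i / real N) c u = (\<Sum>j<k. if j = i then c i else 0)"
    unfolding step_function_def
  proof (intro sum.cong refl)
    fix j assume "j \<in> {..<k}"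
    show "c j * indicator {real j / real N<..real (Suc j) / real N} u = (if j = i then c i else 0)"
    proof (cases "j = i")
      case False
      have "u \<notin> {real j / real N<..real (Suc j) / real N}"
      proof
        assume "u \<in> {real j / real N<..real (Suc j) / real N}"
        with assms have "real j < real (Suc i)" "real i < real (Suc j)"
          by (auto simp: divide_less_eq le_divide_eq)
        then show False using False by auto
      qed
      then show ?thesis using False by simp
    qed (use assms in simp)
  qed
  then show ?thesis using assms by simp
qed

lemma step_function_outside:
  assumes "\<And>i. i < k \<Longrightarrow> 0 \<le> p i" "\<And>i. i < k \<Longrightarrow> p (Suc i) \<le> t" "u \<notin> {0..t}"
  shows "step_function k p c u = 0"
  unfolding step_function_def
proof (intro sum.neutral ballI)
  fix i assume "i \<in> {..<k}"
  then show "c i * indicator {p i<..p (Suc i)} u = 0"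
    using assms(1)[of i] assms(2)[of i] assms(3) by (auto simp: indicator_def)
qed

text \<open>The step function uses left end points and takes the value \<open>0\<close> at the origin, which is a null set.\<close>

lemma riemann_step_error:
  fixes s :: "real \<Rightarrow> real"
  assumes N: "N > 0" and k: "k \<le> N" and lam: "lam > 0"
    and holder: "\<And>u v. u \<in> {0..1} \<Longrightarrow> v \<in> {0..1} \<Longrightarrow> \<bar>s u - s v\<bar> \<le> L * \<bar>u - v\<bar> powr lam"
    and L: "L \<ge> 0"
  shows "(\<integral>\<^sup>+u\<in>{0..real k / real N}. ennreal ((step_function k (\<lambda>i. real i / real N) (\<lambda>i. s (real i / real N)) u - s u)\<^sup>2) \<partial>lborel)
    \<le> ennreal ((L * (1 / real N) powr lam)\<^sup>2)"
proof -
  define e where "e = L * (1 / real N) powr lam"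
  have e: "e \<ge> 0" using L by (simp add: e_def)
  have *: "(step_function k (\<lambda>i. real i / real N) (\<lambda>i. s (real i / real N)) u - s u)\<^sup>2 \<le> e\<^sup>2"
    if u: "0 < u" "u \<le> real k / real N" for u
  proof -
    define i where "i = nat (\<lceil>u * real N\<rceil> - 1)"
    have uN: "0 < u * real N" "u * real N \<le> real k" using u N by (auto simp: le_divide_eq)
    then have "\<lceil>u * real N\<rceil> \<ge> 1" "\<lceil>u * real N\<rceil> \<le> int k" by (auto simp: ceiling_le_iff)
    then have i: "i < k" "real i < u * real N" "u * real N \<le> real (Suc i)"
      unfolding i_def by (auto simp: of_nat_nat) linarith+
    then have ui: "u \<in> {real i / real N<..real (Suc i) / real N}"
      using N by (auto simp: divide_less_eq le_divide_eq)
    have "real k / real N \<le> 1" using k N by simp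
    moreover have "real i / real N \<le> real k / real N" using i by (intro divide_right_mono) auto
    ultimately have in01: "u \<in> {0..1}" "real i / real N \<in> {0..1}" using u by auto
    have "\<bar>real i / real N - u\<bar> \<le> 1 / real N" using ui by (auto simp: add_divide_distrib)
    then have "\<bar>s (real i / real N) - s u\<bar> \<le> e"
      unfolding e_def using holder[OF in01(2,1)] L lam
      by (meson order_trans mult_left_mono powr_mono2 abs_ge_zero less_imp_le)
    then show ?thesis
      using step_function_grid_eq[OF N i(1) ui, of "\<lambda>i. s (real i / real N)"] e by (simp add: abs_le_square_iff[symmetric])
  qed
  have "(\<integral>\<^sup>+u\<in>{0..real k / real N}. ennreal ((step_function k (\<lambda>i. real i / real N) (\<lambda>i. s (real i / real N)) u - s u)\<^sup>2) \<partial>lborel)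
    \<le> (\<integral>\<^sup>+u. ennreal (e\<^sup>2) * indicator {0..real k / real N} u \<partial>lborel)"
  proof (rule nn_integral_mono_AE)
    show "AE u in lborel. ennreal ((step_function k (\<lambda>i. real i / real N) (\<lambda>i. s (real i / real N)) u - s u)\<^sup>2) *
        indicator {0..real k / real N} u \<le> ennreal (e\<^sup>2) * indicator {0..real k / real N} u"
      using AE_lborel_singleton[of 0]
    proof eventually_elim
      case (elim u)
      then show ?case using *[of u] by (auto simp: indicator_def intro!: ennreal_leI)
    qed
  qed
  also have "\<dots> = ennreal (e\<^sup>2) * ennreal (real k / real N)"
    by (subst nn_integral_cmult_indicator) auto
  also have "\<dots> \<le> ennreal (e\<^sup>2) * 1"
    using k N by (intro mult_left_mono) (auto simp: ennreal_le_1)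
  finally show ?thesis by (simp add: e_def)
qed

lemma ennreal_tendsto_scaled_zero:
  fixes f :: "nat \<Rightarrow> ennreal"
  assumes "f \<longlonglongrightarrow> 0"
  shows "(\<lambda>j. 2 * f j) \<longlonglongrightarrow> 0"
  using tendsto_add[OF assms assms] by (simp add: mult_2)

context brownian
begin

lemma step_integral_measurable:
  "unit_partition k p \<Longrightarrow> step_integral W k p c \<in> borel_measurable M"
  unfolding step_integral_def[abs_def] unit_partition_def
  by (intro borel_measurable_sum borel_measurable_times borel_measurable_diff W_measurable) auto

lemma unit_partition_grid: "N > 0 \<Longrightarrow> k \<le> N \<Longrightarrow> unit_partition k (\<lambda>i. real i / real N)"
  by (auto simp: unit_partition_def divide_right_mono)

text \<open>The definition of the Wiener integral provides, for each time, some approximating step functions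
of which nothing is known. By the isometry every sequence that
converges to \<open>s\<close> in \<open>L\<^sup>2\<close> has the same limit, in particular the left Riemann sums on the
grids of mesh \<open>1 / (n * Suc j)\<close>. All these grids contain the observation times, so that
for different cells the Riemann sums use disjoint sets of Brownian increments.\<close>

lemma riemann_sums_tendsto_Wiener_integral:
  fixes s :: "real \<Rightarrow> real"
  assumes n: "n > 0" and i: "i \<le> n" and lam: "lam > 0" and L: "L \<ge> 0"
    and holder: "\<And>u v. u \<in> {0..1} \<Longrightarrow> v \<in> {0..1} \<Longrightarrow> \<bar>s u - s v\<bar> \<le> L * \<bar>u - v\<bar> powr lam"
    and J: "is_Wiener_integral M W s (real i / real n) J"
  shows "(\<lambda>j. \<integral>\<^sup>+\<omega>. ennreal ((step_integral W (i * Suc j) (\<lambda>l. real l / real (n * Suc j))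
      (\<lambda>l. s (real l / real (n * Suc j))) \<omega> - J \<omega>)\<^sup>2) \<partial>M) \<longlonglongrightarrow> 0"
proof -
  define t where "t = real i / real n"
  have t: "0 \<le> t" "t \<le> 1" using n i by (auto simp: t_def)
  obtain k p c where p: "\<And>j. p j 0 = 0" "\<And>j. p j (k j) = t" "\<And>j l. l < k j \<Longrightarrow> p j l \<le> p j (Suc l)"
    and conv_f: "(\<lambda>j. \<integral>\<^sup>+u\<in>{0..t}. ennreal ((step_function (k j) (p j) (c j) u - s u)\<^sup>2) \<partial>lborel) \<longlonglongrightarrow> 0"
    and conv_J: "(\<lambda>j. \<integral>\<^sup>+\<omega>. ennreal ((step_integral W (k j) (p j) (c j) \<omega> - J \<omega>)\<^sup>2) \<partial>M) \<longlonglongrightarrow> 0"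
    using J unfolding is_Wiener_integral_def t_def by blast
  have J_meas [measurable]: "J \<in> borel_measurable M"
    and s_meas: "set_borel_measurable lborel {0..t} s"
    using J unfolding is_Wiener_integral_def t_def by auto
  have mono: "p j l \<le> p j l'" if "l \<le> l'" "l' \<le> k j" for j l l'
    using that
  proof (induction l' rule: dec_induct)
    case (step i)
    then show ?case using p(3)[of i j] by simp
  qed simp
  have p_range: "0 \<le> p j l" "p j l \<le> t" if "l \<le> k j" for j l
    using mono[of 0 l j] mono[of l "k j" j] that p by auto
  have part_p: "unit_partition (k j) (p j)" for j
    unfolding unit_partition_def using p_range p(3) t by fastforce
  define N where "N j = n * Suc j" for j
  define q where "q j l = real l / real (N j)" for j l
  define K where "K j = i * Suc j" for j
  define d where "d j l = s (q j l)" for j l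
  have N: "N j > 0" "K j \<le> N j" for j using n mult_le_mono1[OF i, of "Suc j"] by (simp_all only: N_def K_def nat_0_less_mult_iff zero_less_Suc)
  have part_q: "unit_partition (K j) (q j)" for j
    unfolding q_def[abs_def] by (rule unit_partition_grid[OF N])
  have q_end: "q j (K j) = t" for j
    unfolding q_def K_def N_def t_def of_nat_mult by (rule mult_divide_mult_cancel_right) simp
  have q_le: "q j l \<le> t" if "l \<le> K j" for j l
    unfolding q_end[of j, symmetric] q_def using that by (intro divide_right_mono) auto
  note [measurable] = step_integral_measurable[OF part_p] step_integral_measurable[OF part_q]
  define s' where "s' u = indicator {0..t} u * s u" for u
  have [measurable]: "s' \<in> borel_measurable lborel"
    using s_meas unfolding s'_def[abs_def] set_borel_measurable_def by simp
  have step_p: "step_function (k j) (p j) (c j) u = 0" if "u \<notin> {0..t}" for j u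
    using that p_range by (intro step_function_outside) auto
  have step_q: "step_function (K j) (q j) (d j) u = 0" if "u \<notin> {0..t}" for j u
    using that by (intro step_function_outside[of _ _ t] q_le) (auto simp: q_def)
  have dist_p: "(\<integral>\<^sup>+u. ennreal ((s' u - step_function (k j) (p j) (c j) u)\<^sup>2) \<partial>lborel) =
      (\<integral>\<^sup>+u\<in>{0..t}. ennreal ((step_function (k j) (p j) (c j) u - s u)\<^sup>2) \<partial>lborel)" for j
    by (intro nn_integral_cong) (auto simp: s'_def indicator_def step_p power2_commute)
  have dist_q: "(\<integral>\<^sup>+u. ennreal ((step_function (K j) (q j) (d j) u - s' u)\<^sup>2) \<partial>lborel) =
      (\<integral>\<^sup>+u\<in>{0..t}. ennreal ((step_function (K j) (q j) (d j) u - s u)\<^sup>2) \<partial>lborel)" for j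
    by (intro nn_integral_cong) (auto simp: s'_def indicator_def step_q)
  have conv_q: "(\<lambda>j. \<integral>\<^sup>+u\<in>{0..t}. ennreal ((step_function (K j) (q j) (d j) u - s u)\<^sup>2) \<partial>lborel) \<longlonglongrightarrow> 0"
  proof (rule tendsto_sandwich[OF _ _ tendsto_const])
    show "\<forall>\<^sub>F j in sequentially. (\<integral>\<^sup>+u\<in>{0..t}. ennreal ((step_function (K j) (q j) (d j) u - s u)\<^sup>2) \<partial>lborel)
        \<le> ennreal ((L * (1 / real (N j)) powr lam)\<^sup>2)"
    proof (intro always_eventually allI)
      fix j
      have "real (K j) / real (N j) = t" using q_end[of j] by (simp add: q_def)
      then show "(\<integral>\<^sup>+u\<in>{0..t}. ennreal ((step_function (K j) (q j) (d j) u - s u)\<^sup>2) \<partial>lborel)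
        \<le> ennreal ((L * (1 / real (N j)) powr lam)\<^sup>2)"
        using riemann_step_error[OF N[of j] lam holder L] unfolding q_def[abs_def] d_def[abs_def] by simp
    qed
    have "filterlim N at_top sequentially"
      unfolding N_def[abs_def] using n by (intro filterlim_subseq strict_monoI) auto
    then have "filterlim (\<lambda>j. real (N j)) at_top sequentially"
      by (rule filterlim_compose[OF filterlim_real_sequentially])
    then have "(\<lambda>j. (1 / real (N j)) powr lam) \<longlonglongrightarrow> 0"
      using lam by (intro tendsto_zero_powrI[where b = lam])
        (auto intro!: real_tendsto_divide_at_top[where c = 1])
    then have "(\<lambda>j. (L * (1 / real (N j)) powr lam)\<^sup>2) \<longlonglongrightarrow> (L * 0)\<^sup>2"
      by (intro tendsto_intros)
    then show "(\<lambda>j. ennreal ((L * (1 / real (N j)) powr lam)\<^sup>2)) \<longlonglongrightarrow> 0"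
      using tendsto_ennrealI by fastforce
  qed auto
  define E where "E j = 2 * (2 * (\<integral>\<^sup>+u\<in>{0..t}. ennreal ((step_function (K j) (q j) (d j) u - s u)\<^sup>2) \<partial>lborel)
      + 2 * (\<integral>\<^sup>+u\<in>{0..t}. ennreal ((step_function (k j) (p j) (c j) u - s u)\<^sup>2) \<partial>lborel))
      + 2 * (\<integral>\<^sup>+\<omega>. ennreal ((step_integral W (k j) (p j) (c j) \<omega> - J \<omega>)\<^sup>2) \<partial>M)" for j
  have bound: "(\<integral>\<^sup>+\<omega>. ennreal ((step_integral W (K j) (q j) (d j) \<omega> - J \<omega>)\<^sup>2) \<partial>M) \<le> E j" for j
  proof -
    have "(\<integral>\<^sup>+\<omega>. ennreal ((step_integral W (K j) (q j) (d j) \<omega> - step_integral W (k j) (p j) (c j) \<omega>)\<^sup>2) \<partial>M)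
      \<le> 2 * (\<integral>\<^sup>+u\<in>{0..t}. ennreal ((step_function (K j) (q j) (d j) u - s u)\<^sup>2) \<partial>lborel)
      + 2 * (\<integral>\<^sup>+u\<in>{0..t}. ennreal ((step_function (k j) (p j) (c j) u - s u)\<^sup>2) \<partial>lborel)"
      unfolding step_integral_isometry[OF part_q part_p] dist_p[symmetric] dist_q[symmetric]
      by (rule nn_integral_sq_dist_triangle) auto
    moreover have "(\<integral>\<^sup>+\<omega>. ennreal ((step_integral W (K j) (q j) (d j) \<omega> - J \<omega>)\<^sup>2) \<partial>M) \<le>
        2 * (\<integral>\<^sup>+\<omega>. ennreal ((step_integral W (K j) (q j) (d j) \<omega> - step_integral W (k j) (p j) (c j) \<omega>)\<^sup>2) \<partial>M) +
        2 * (\<integral>\<^sup>+\<omega>. ennreal ((step_integral W (k j) (p j) (c j) \<omega> - J \<omega>)\<^sup>2) \<partial>M)"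
      by (rule nn_integral_sq_dist_triangle) auto
    ultimately show ?thesis
      unfolding E_def by (meson add_right_mono mult_left_mono order_trans zero_le)
  qed
  have "E \<longlonglongrightarrow> 0"
    using tendsto_add[OF ennreal_tendsto_scaled_zero[OF
        tendsto_add[OF ennreal_tendsto_scaled_zero[OF conv_q] ennreal_tendsto_scaled_zero[OF conv_f], simplified]]
        ennreal_tendsto_scaled_zero[OF conv_J]]
    unfolding E_def[abs_def] by simp
  then have "(\<lambda>j. \<integral>\<^sup>+\<omega>. ennreal ((step_integral W (K j) (q j) (d j) \<omega> - J \<omega>)\<^sup>2) \<partial>M) \<longlonglongrightarrow> 0"
    by (rule tendsto_sandwich[OF _ _ tendsto_const, rotated -1]) (auto simp: bound)
  then show ?thesis
    unfolding K_def q_def[abs_def] d_def[abs_def] N_def .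
qed

end

section \<open>The realised variance of a Wiener integral\<close>

context brownian
begin

text \<open>The sums over different cells are functions of disjoint groups of independent Brownian increments.\<close>

lemma riemann_cell_sums_indep_normal:
  fixes s :: "real \<Rightarrow> real"
  assumes n: "n > 0" and j: "j > 0" and s_pos: "\<forall>u\<in>{0..1}. s u > 0"
  defines "N \<equiv> n * j"
  defines "G \<equiv> \<lambda>i \<omega>. \<Sum>l\<in>{(i - 1) * j..<i * j}. s (real l / real N) * (W (real (Suc l) / real N) \<omega> - W (real l / real N) \<omega>)"
    and "V \<equiv> \<lambda>i. \<Sum>l\<in>{(i - 1) * j..<i * j}. (s (real l / real N))\<^sup>2 / real N"
  shows "indep_vars (\<lambda>_. borel) G {1..n}"
    and "\<And>i. i \<in> {1..n} \<Longrightarrow> distributed M lborel (G i) (normal_density 0 (sqrt (V i)))"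
    and "\<And>i. i \<in> {1..n} \<Longrightarrow> V i > 0"
proof -
  have N: "N > 0" using n j by (simp add: N_def)
  define D where "D l \<omega> = W (real (Suc l) / real N) \<omega> - W (real l / real N) \<omega>" for l \<omega>
  define X where "X l \<omega> = s (real l / real N) * D l \<omega>" for l \<omega>
  define C where "C i = {(i - 1) * j..<i * j}" for i
  have C_ne: "C i \<noteq> {}" if "i \<in> {1..n}" for i
  proof -
    have "(i - 1) * j < i * j" using that j by simp
    then show ?thesis by (simp add: C_def)
  qed
  have C_sub: "C i \<subseteq> {..<N}" if "i \<in> {1..n}" for i
  proof -
    have "i * j \<le> N" unfolding N_def using that by (intro mult_le_mono1) auto
    then show ?thesis by (auto simp: C_def)
  qed
  have C_disj: "disjoint_family_on C {1..n}"
  proof -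
    have "C i \<inter> C i' = {}" if "i < i'" for i i'
    proof -
      have "i * j \<le> (i' - 1) * j" using that by (intro mult_le_mono1) auto
      moreover have "l < i * j" if "l \<in> C i" for l using that by (simp add: C_def)
      moreover have "(i' - 1) * j \<le> l" if "l \<in> C i'" for l using that by (simp add: C_def)
      ultimately show ?thesis by (meson disjoint_iff leD le_trans)
    qed
    then show ?thesis unfolding disjoint_family_on_def by (metis inf_commute linorder_neqE_nat)
  qed
  have s_grid: "s (real l / real N) > 0" if "l < N" for l
    using that N by (intro s_pos[rule_format]) auto
  have indD: "indep_vars (\<lambda>_. borel) D {..<N}"
    unfolding D_def[abs_def] using N by (intro increment_indep) (auto simp: divide_strict_right_mono)
  have indX: "indep_vars (\<lambda>_. borel) X {..<N}"
    unfolding X_def[abs_def] by (rule indep_vars_compose2[OF indD]) auto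
  have normX: "distributed M lborel (X l) (normal_density 0 (s (real l / real N) * sqrt (1 / real N)))"
    if l: "l < N" for l
  proof -
    have "distributed M lborel (D l) (normal_density 0 (sqrt (real (Suc l) / real N - real l / real N)))"
      unfolding D_def[abs_def] using l N by (intro increment_normal) (auto simp: divide_strict_right_mono)
    moreover have "real (Suc l) / real N - real l / real N = 1 / real N"
      by (simp add: diff_divide_distrib[symmetric])
    ultimately have "distributed M lborel (D l) (normal_density 0 (sqrt (1 / real N)))" by simp
    from normal_density_affine[OF this, of "s (real l / real N)" 0]
    show ?thesis using s_grid[OF l] N by (simp add: X_def[abs_def])
  qed
  have G_eq: "G i = (\<lambda>\<omega>. \<Sum>l\<in>C i. X l \<omega>)" for i
    by (simp add: G_def C_def X_def D_def)
  have "indep_vars (\<lambda>_. borel) (\<lambda>i \<omega>. \<Sum>l\<in>C i. restrict (\<lambda>l. X l \<omega>) (C i) l) {1..n}"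
  proof (rule indep_vars_compose2[OF indep_vars_restrict[OF indX C_sub C_disj]])
    fix i
    show "(\<lambda>f. \<Sum>l\<in>C i. f l) \<in> borel_measurable (Pi\<^sub>M (C i) (\<lambda>_. borel :: real measure))"
    proof (rule borel_measurable_sum[where f = "\<lambda>l f. f l"])
      fix l assume "l \<in> C i"
      then show "(\<lambda>f. f l) \<in> borel_measurable (Pi\<^sub>M (C i) (\<lambda>_. borel :: real measure))"
        using measurable_component_singleton[of l "C i" "\<lambda>_. borel"] by simp
    qed
  qed
  then show "indep_vars (\<lambda>_. borel) G {1..n}"
    unfolding G_eq[abs_def] by simp
  fix i assume i: "i \<in> {1..n}"
  have "distributed M lborel (\<lambda>\<omega>. \<Sum>l\<in>C i. X l \<omega>)
      (normal_density (\<Sum>l\<in>C i. 0) (sqrt (\<Sum>l\<in>C i. (s (real l / real N) * sqrt (1 / real N))\<^sup>2)))"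
    using C_ne[OF i] C_sub[OF i] indep_vars_subset[OF indX C_sub[OF i]] N
    by (intro sum_indep_normal) (auto simp: C_def intro!: normX mult_pos_pos s_grid)
  moreover have "(\<Sum>l\<in>C i. (s (real l / real N) * sqrt (1 / real N))\<^sup>2) = V i"
    unfolding V_def C_def using N by (simp add: power_mult_distrib)
  ultimately show "distributed M lborel (G i) (normal_density 0 (sqrt (V i)))"
    by (simp add: G_eq)
  show "V i > 0"
    unfolding V_def C_def[symmetric]
  proof (rule sum_pos)
    fix l assume "l \<in> C i"
    then show "0 < (s (real l / real N))\<^sup>2 / real N" using C_sub[OF i] N s_grid[of l] by auto
  qed (use C_ne[OF i] in \<open>auto simp: C_def\<close>)
qed

text \<open>The variance \<open>V i\<close> of the increment over the \<open>i\<close>-th cell is \<open>1/n\<close> times an average of values of \<open>s\<^sup>2\<close>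
in that cell. Hence \<open>V i \<le> S / n\<close>, which bounds the variance of the estimator by \<open>2 S\<^sup>2 / card I\<close>, and
\<open>n * V i\<close> is within \<open>\<eta>\<close> of \<open>a\<close>, which bounds its bias by \<open>\<eta>\<close>.\<close>

lemma realized_variance_moment_riemann:
  fixes s :: "real \<Rightarrow> real"
  assumes n: "n > 0" and j: "j > 0" and s_pos: "\<forall>u\<in>{0..1}. s u > 0"
    and I: "I \<subseteq> {1..n}" "I \<noteq> {}"
    and S: "\<And>u. u \<in> {0..1} \<Longrightarrow> (s u)\<^sup>2 \<le> S"
    and osc: "\<And>i u. i \<in> I \<Longrightarrow> u \<in> {real (i - 1) / real n..<real i / real n} \<Longrightarrow> \<bar>(s u)\<^sup>2 - a\<bar> \<le> \<eta>"
  defines "N \<equiv> n * j"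
  defines "G \<equiv> \<lambda>i \<omega>. \<Sum>l\<in>{(i - 1) * j..<i * j}. s (real l / real N) * (W (real (Suc l) / real N) \<omega> - W (real l / real N) \<omega>)"
  shows "(\<integral>\<^sup>+\<omega>. ennreal ((real n * (\<Sum>i\<in>I. (G i \<omega>)\<^sup>2) / real (card I) - a)\<^sup>2) \<partial>M)
    \<le> ennreal (2 * S\<^sup>2 / real (card I) + \<eta>\<^sup>2)"
proof -
  have N: "N > 0" using n j by (simp add: N_def)
  define V where "V i = (\<Sum>l\<in>{(i - 1) * j..<i * j}. (s (real l / real N))\<^sup>2 / real N)" for i
  define w where "w = card I"
  have fin: "finite I" using I finite_subset by blast
  have w: "w > 0" using fin I by (simp add: w_def card_gt_0_iff)
  note GV = riemann_cell_sums_indep_normal[where s = s, OF n j s_pos, folded N_def, folded G_def V_def]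
  have grid: "real l / real N \<in> {0..1}" "real l / real N \<in> {real (i - 1) / real n..<real i / real n}"
    if "i \<in> I" "l \<in> {(i - 1) * j..<i * j}" for i l
  proof -
    have "(i - 1) * j \<le> l" "l < i * j" using that by auto
    then have "real (i - 1) * real j \<le> real l" "real l < real i * real j"
      by (simp_all only: of_nat_mult[symmetric] of_nat_le_iff of_nat_less_iff)
    then show A: "real l / real N \<in> {real (i - 1) / real n..<real i / real n}"
      using n j by (auto simp: N_def field_simps)
    have "real i / real n \<le> 1" using that I n by auto
    then show "real l / real N \<in> {0..1}" using A by auto
  qed
  have card_cell: "card {(i - 1) * j..<i * j} = j" if "i \<in> I" for i
    using that I by (cases i) auto
  have V_le: "V i \<le> S / real n" if i: "i \<in> I" for i
  proof -
    have "V i \<le> (\<Sum>l\<in>{(i - 1) * j..<i * j}. S / real N)"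
      unfolding V_def using grid[OF i] by (intro sum_mono divide_right_mono S) auto
    also have "\<dots> = S / real n" using card_cell[OF i] j n by (simp add: N_def)
    finally show ?thesis .
  qed
  have V_near: "\<bar>real n * V i - a\<bar> \<le> \<eta>" if i: "i \<in> I" for i
  proof -
    have "real n * V i - a = (\<Sum>l\<in>{(i - 1) * j..<i * j}. ((s (real l / real N))\<^sup>2 - a) / real j)"
      unfolding V_def sum_distrib_left diff_divide_distrib sum_subtractf
      using card_cell[OF i] j n by (simp add: N_def)
    also have "\<bar>\<dots>\<bar> \<le> (\<Sum>l\<in>{(i - 1) * j..<i * j}. \<eta> / real j)"
      using osc[OF i grid(2)[OF i]]
      by (intro order_trans[OF sum_abs] sum_mono) (auto simp: abs_divide divide_right_mono)
    also have "\<dots> = \<eta>" using card_cell[OF i] j by simp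
    finally show ?thesis .
  qed
  have eq: "(real n * Q / real w - a)\<^sup>2 = (real n / real w)\<^sup>2 * (Q - real w * a / real n)\<^sup>2" for Q
    using n w by (simp add: power_mult_distrib[symmetric] right_diff_distrib)
  have "has_bochner_integral M (\<lambda>\<omega>. (real n / real w)\<^sup>2 * ((\<Sum>i\<in>I. (G i \<omega>)\<^sup>2) - real w * a / real n)\<^sup>2)
      ((real n / real w)\<^sup>2 * (2 * (\<Sum>i\<in>I. sqrt (V i) ^ 4) + ((\<Sum>i\<in>I. (sqrt (V i))\<^sup>2) - real w * a / real n)\<^sup>2))"
  proof (intro has_bochner_integral_mult_right second_moment_sum_squares_indep_normal fin
      indep_vars_subset[OF GV(1) I(1)])
    fix i assume "i \<in> I"
    then have i: "i \<in> {1..n}" using I by auto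
    show "distributed M lborel (G i) (normal_density 0 (sqrt (V i)))"
      unfolding G_def by (rule GV(2)[OF i])
    show "0 < sqrt (V i)" using GV(3)[OF i] by simp
  qed
  then have "(\<integral>\<^sup>+\<omega>. ennreal ((real n * (\<Sum>i\<in>I. (G i \<omega>)\<^sup>2) / real w - a)\<^sup>2) \<partial>M) =
      ennreal ((real n / real w)\<^sup>2 * (2 * (\<Sum>i\<in>I. sqrt (V i) ^ 4) + ((\<Sum>i\<in>I. (sqrt (V i))\<^sup>2) - real w * a / real n)\<^sup>2))"
    unfolding eq using n w by (simp add: has_bochner_integral_iff nn_integral_eq_integral)
  also have "\<dots> \<le> ennreal (2 * S\<^sup>2 / real w + \<eta>\<^sup>2)"
  proof (rule ennreal_leI)
    have V0: "V i \<ge> 0" for i unfolding V_def by (intro sum_nonneg) auto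
    have "(\<Sum>i\<in>I. sqrt (V i) ^ 4) = (\<Sum>i\<in>I. (V i)\<^sup>2)"
      using V0 by (intro sum.cong refl) (simp add: power4_eq_xxxx power2_eq_square)
    also have "\<dots> \<le> (\<Sum>i\<in>I. (S / real n)\<^sup>2)"
      using V0 V_le by (intro sum_mono power_mono) auto
    also have "\<dots> = real w * (S / real n)\<^sup>2" by (simp add: w_def)
    finally have "(real n / real w)\<^sup>2 * (2 * (\<Sum>i\<in>I. sqrt (V i) ^ 4)) \<le>
        (real n / real w)\<^sup>2 * (2 * (real w * (S / real n)\<^sup>2))"
      by (intro mult_left_mono) auto
    also have "\<dots> = 2 * S\<^sup>2 / real w"
      using n w by (simp add: power_divide power2_eq_square)
    finally have 1: "(real n / real w)\<^sup>2 * (2 * (\<Sum>i\<in>I. sqrt (V i) ^ 4)) \<le> 2 * S\<^sup>2 / real w" .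
    have "real n * (\<Sum>i\<in>I. V i) / real w - a = (\<Sum>i\<in>I. (real n * V i - a) / real w)"
      using w by (simp add: sum_distrib_left sum_subtractf diff_divide_distrib sum_divide_distrib w_def)
    also have "\<bar>\<dots>\<bar> \<le> (\<Sum>i\<in>I. \<eta> / real w)"
      using V_near by (intro order_trans[OF sum_abs] sum_mono) (auto simp: abs_divide divide_right_mono)
    also have "\<dots> = \<eta>" using w by (simp add: w_def)
    finally have "(real n * (\<Sum>i\<in>I. V i) / real w - a)\<^sup>2 \<le> \<eta>\<^sup>2"
      by (simp add: abs_le_square_iff[symmetric])
    then have 2: "(real n / real w)\<^sup>2 * ((\<Sum>i\<in>I. (sqrt (V i))\<^sup>2) - real w * a / real n)\<^sup>2 \<le> \<eta>\<^sup>2"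
      unfolding eq[symmetric] using V0 by simp
    show "(real n / real w)\<^sup>2 * (2 * (\<Sum>i\<in>I. sqrt (V i) ^ 4) + ((\<Sum>i\<in>I. (sqrt (V i))\<^sup>2) - real w * a / real n)\<^sup>2)
        \<le> 2 * S\<^sup>2 / real w + \<eta>\<^sup>2"
      unfolding distrib_left using 1 2 by linarith
  qed
  finally show ?thesis by (simp add: w_def)
qed

text \<open>The sum over all observation times of the squared errors tends to \<open>0\<close> in \<open>L\<^sup>1\<close>, so one subsequence
serves all times simultaneously.\<close>

lemma riemann_sums_AE_subsequence:
  fixes s :: "real \<Rightarrow> real"
  assumes n: "n > 0" and lam: "lam > 0" and L: "L \<ge> 0"
    and holder: "\<And>u v. u \<in> {0..1} \<Longrightarrow> v \<in> {0..1} \<Longrightarrow> \<bar>s u - s v\<bar> \<le> L * \<bar>u - v\<bar> powr lam"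
    and J: "\<And>i. i \<le> n \<Longrightarrow> is_Wiener_integral M W s (real i / real n) (J i)"
  obtains \<rho> :: "nat \<Rightarrow> nat" where "AE \<omega> in M. \<forall>i\<le>n.
      (\<lambda>j. step_integral W (i * Suc (\<rho> j)) (\<lambda>l. real l / real (n * Suc (\<rho> j)))
        (\<lambda>l. s (real l / real (n * Suc (\<rho> j)))) \<omega>) \<longlonglongrightarrow> J i \<omega>"
proof -
  define R where "R j i = step_integral W (i * Suc j) (\<lambda>l. real l / real (n * Suc j))
      (\<lambda>l. s (real l / real (n * Suc j)))" for j i
  have R_meas: "R j i \<in> borel_measurable M" if "i \<le> n" for i j
    unfolding R_def using n that by (intro step_integral_measurable unit_partition_grid mult_le_mono1) auto
  have J_meas: "J i \<in> borel_measurable M" if "i \<le> n" for i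
    using J[OF that] by (simp add: is_Wiener_integral_def)
  define e where "e j \<omega> = (\<Sum>i\<le>n. (R j i \<omega> - J i \<omega>)\<^sup>2)" for j \<omega>
  have e_meas [measurable]: "e j \<in> borel_measurable M" for j
    unfolding e_def[abs_def] using R_meas J_meas by (intro borel_measurable_sum borel_measurable_power borel_measurable_diff) auto
  have e_nonneg: "e j \<omega> \<ge> 0" for j \<omega> unfolding e_def by (intro sum_nonneg) auto
  have "(\<integral>\<^sup>+\<omega>. ennreal (e j \<omega>) \<partial>M) = (\<Sum>i\<le>n. \<integral>\<^sup>+\<omega>. ennreal ((R j i \<omega> - J i \<omega>)\<^sup>2) \<partial>M)" for j
    unfolding e_def using R_meas J_meas
    by (subst nn_integral_sum[symmetric]) (auto intro!: borel_measurable_power borel_measurable_diff measurable_compose[OF _ measurable_ennreal])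
  moreover have "(\<lambda>j. \<Sum>i\<le>n. \<integral>\<^sup>+\<omega>. ennreal ((R j i \<omega> - J i \<omega>)\<^sup>2) \<partial>M) \<longlonglongrightarrow> (\<Sum>i\<le>n. 0)"
    unfolding R_def by (intro tendsto_sum riemann_sums_tendsto_Wiener_integral[OF n _ lam L holder] J) auto
  ultimately have lim: "(\<lambda>j. \<integral>\<^sup>+\<omega>. ennreal (e j \<omega>) \<partial>M) \<longlonglongrightarrow> 0" by simp
  then have "\<forall>\<^sub>F j in sequentially. (\<integral>\<^sup>+\<omega>. ennreal (e j \<omega>) \<partial>M) < 1"
    by (rule order_tendstoD) simp
  \<comment> \<open>Only from some index on are the errors known to be integrable, so the sequence is shifted.\<close>
  then obtain j0 where j0: "\<And>j. j \<ge> j0 \<Longrightarrow> (\<integral>\<^sup>+\<omega>. ennreal (e j \<omega>) \<partial>M) < 1"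
    by (auto simp: eventually_sequentially)
  define u where "u j = e (j + j0)" for j
  have fin: "(\<integral>\<^sup>+\<omega>. ennreal (u j \<omega>) \<partial>M) < \<infinity>" for j
    using j0[of "j + j0"] unfolding u_def by (auto intro: order_less_trans)
  have int: "integrable M (u j)" for j
    using fin[of j] e_nonneg by (intro integrableI_bounded) (auto simp: u_def)
  have "(\<lambda>j. \<integral>\<omega>. norm (u j \<omega>) \<partial>M) = (\<lambda>j. enn2real (\<integral>\<^sup>+\<omega>. ennreal (u j \<omega>) \<partial>M))"
    using e_nonneg by (auto simp: u_def integral_eq_nn_integral)
  also have "\<dots> \<longlonglongrightarrow> enn2real 0"
    using LIMSEQ_ignore_initial_segment[OF lim, of j0] by (intro tendsto_enn2real) (auto simp: u_def)
  finally obtain r where "AE \<omega> in M. (\<lambda>j. u (r j) \<omega>) \<longlonglongrightarrow> 0"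
    using tendsto_L1_AE_subseq[of M u, OF int] by auto
  then have "AE \<omega> in M. \<forall>i\<le>n. (\<lambda>j. R (r j + j0) i \<omega>) \<longlonglongrightarrow> J i \<omega>"
  proof eventually_elim
    case (elim \<omega>)
    show ?case
    proof (intro allI impI)
      fix i assume i: "i \<le> n"
      have "(\<lambda>j. (R (r j + j0) i \<omega> - J i \<omega>)\<^sup>2) \<longlonglongrightarrow> 0"
      proof (rule tendsto_sandwich[OF _ _ tendsto_const elim])
        show "\<forall>\<^sub>F j in sequentially. (R (r j + j0) i \<omega> - J i \<omega>)\<^sup>2 \<le> u (r j) \<omega>"
          unfolding u_def e_def using i
          by (intro always_eventually allI member_le_sum[where f = "\<lambda>i. (R _ i \<omega> - J i \<omega>)\<^sup>2"]) auto
      qed auto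
      then have "(\<lambda>j. R (r j + j0) i \<omega> - J i \<omega>) \<longlonglongrightarrow> 0"
        using tendsto_real_sqrt by (fastforce simp: tendsto_rabs_zero_iff)
      then show "(\<lambda>j. R (r j + j0) i \<omega>) \<longlonglongrightarrow> J i \<omega>" by (simp add: LIM_zero_iff)
    qed
  qed
  then show ?thesis unfolding R_def by (rule that[of "\<lambda>j. r j + j0"])
qed

text \<open>The bound for Riemann sums is uniform in the grid and passes to the limit by Fatou's lemma.\<close>

lemma realized_variance_moment:
  fixes s :: "real \<Rightarrow> real"
  assumes n: "n > 0" and lam: "lam > 0" and L: "L \<ge> 0"
    and holder: "\<And>u v. u \<in> {0..1} \<Longrightarrow> v \<in> {0..1} \<Longrightarrow> \<bar>s u - s v\<bar> \<le> L * \<bar>u - v\<bar> powr lam"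
    and J: "\<And>i. i \<le> n \<Longrightarrow> is_Wiener_integral M W s (real i / real n) (J i)"
    and s_pos: "\<forall>u\<in>{0..1}. s u > 0"
    and I: "I \<subseteq> {1..n}" "I \<noteq> {}"
    and S: "\<And>u. u \<in> {0..1} \<Longrightarrow> (s u)\<^sup>2 \<le> S"
    and osc: "\<And>i u. i \<in> I \<Longrightarrow> u \<in> {real (i - 1) / real n..<real i / real n} \<Longrightarrow> \<bar>(s u)\<^sup>2 - a\<bar> \<le> \<eta>"
  shows "(\<integral>\<^sup>+\<omega>. ennreal ((real n * (\<Sum>i\<in>I. (J i \<omega> - J (i - 1) \<omega>)\<^sup>2) / real (card I) - a)\<^sup>2) \<partial>M)
    \<le> ennreal (2 * S\<^sup>2 / real (card I) + \<eta>\<^sup>2)"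
proof -
  define R where "R j i = step_integral W (i * Suc j) (\<lambda>l. real l / real (n * Suc j))
      (\<lambda>l. s (real l / real (n * Suc j)))" for j i
  obtain \<rho> where lim: "AE \<omega> in M. \<forall>i\<le>n. (\<lambda>j. R (\<rho> j) i \<omega>) \<longlonglongrightarrow> J i \<omega>"
    using riemann_sums_AE_subsequence[OF n lam L holder J] unfolding R_def by blast
  have R_meas: "R j i \<in> borel_measurable M" if "i \<le> n" for i j
    unfolding R_def using n that by (intro step_integral_measurable unit_partition_grid mult_le_mono1) auto
  define F where "F g = (real n * (\<Sum>i\<in>I. (g i - g (i - 1))\<^sup>2) / real (card I) - a)\<^sup>2" for g :: "nat \<Rightarrow> real"
  have card_I: "real (card I) \<noteq> 0" using I finite_subset[OF I(1)] by simp
  have I_le: "i \<le> n" "i - 1 \<le> n" if "i \<in> I" for i using subsetD[OF I(1) that] by auto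
  have F_meas: "(\<lambda>\<omega>. F (\<lambda>i. R j i \<omega>)) \<in> borel_measurable M" for j
    unfolding F_def
    by (intro borel_measurable_power borel_measurable_diff borel_measurable_divide borel_measurable_times
        borel_measurable_sum borel_measurable_const R_meas I_le)
  have bound: "(\<integral>\<^sup>+\<omega>. ennreal (F (\<lambda>i. R j i \<omega>)) \<partial>M) \<le> ennreal (2 * S\<^sup>2 / real (card I) + \<eta>\<^sup>2)" for j
  proof -
    have inc: "R j i \<omega> - R j (i - 1) \<omega> = (\<Sum>l\<in>{(i - 1) * Suc j..<i * Suc j}. s (real l / real (n * Suc j)) *
        (W (real (Suc l) / real (n * Suc j)) \<omega> - W (real l / real (n * Suc j)) \<omega>))" for i \<omega>
      unfolding R_def step_integral_def
      by (subst sum_diff[symmetric]) (auto intro!: sum.cong simp del: mult_Suc_right)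
    show ?thesis
      unfolding F_def inc
      by (rule realized_variance_moment_riemann[OF n _ s_pos I S osc]) auto
  qed
  have "(\<integral>\<^sup>+\<omega>. ennreal (F (\<lambda>i. J i \<omega>)) \<partial>M) \<le> (\<integral>\<^sup>+\<omega>. liminf (\<lambda>j. ennreal (F (\<lambda>i. R (\<rho> j) i \<omega>))) \<partial>M)"
  proof (rule nn_integral_mono_AE)
    show "AE \<omega> in M. ennreal (F (\<lambda>i. J i \<omega>)) \<le> liminf (\<lambda>j. ennreal (F (\<lambda>i. R (\<rho> j) i \<omega>)))"
      using lim
    proof eventually_elim
      case (elim \<omega>)
      have "(\<lambda>j. F (\<lambda>i. R (\<rho> j) i \<omega>)) \<longlonglongrightarrow> F (\<lambda>i. J i \<omega>)"
        unfolding F_def using elim I_le card_I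
        by (intro tendsto_power tendsto_diff tendsto_divide tendsto_mult tendsto_sum tendsto_const) auto
      then have "(\<lambda>j. ennreal (F (\<lambda>i. R (\<rho> j) i \<omega>))) \<longlonglongrightarrow> ennreal (F (\<lambda>i. J i \<omega>))"
        by (rule tendsto_ennrealI)
      then show ?case by (simp add: lim_imp_Liminf)
    qed
  qed
  also have "\<dots> \<le> liminf (\<lambda>j. \<integral>\<^sup>+\<omega>. ennreal (F (\<lambda>i. R (\<rho> j) i \<omega>)) \<partial>M)"
    using F_meas by (intro nn_integral_liminf) auto
  also have "\<dots> \<le> ennreal (2 * S\<^sup>2 / real (card I) + \<eta>\<^sup>2)"
    using bound by (intro Liminf_le) auto
  finally show ?thesis unfolding F_def .
qed

end

section \<open>From the posterior mean to the realised variance\<close>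

lemma power2_sum_le: "(x + y)\<^sup>2 \<le> 2 * x\<^sup>2 + 2 * y\<^sup>2" for x y :: real
  using zero_le_power2[of "x - y"] by (simp add: power2_eq_square algebra_simps)

text \<open>Here \<open>D\<close> is the drift part and \<open>G\<close> the noise part of the increments. The cross term
\<open>2 \<Sum>D G\<close> dominates; by the Cauchy-Schwarz inequality its square is at most
\<open>4 (\<Sum>D\<^sup>2) (\<Sum>G\<^sup>2)\<close>, and \<open>\<Sum>D\<^sup>2 \<le> w (c/n)\<^sup>2\<close>.\<close>

lemma perturbed_sum_squares_close:
  fixes D G :: "'i \<Rightarrow> real" and n :: real
  assumes fin: "finite I" and I: "I \<noteq> {}" and n: "n \<ge> real (card I)" and c: "c \<ge> 0"
    and D: "\<And>i. i \<in> I \<Longrightarrow> \<bar>D i\<bar> \<le> c / n"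
  defines "w \<equiv> real (card I)"
  shows "(n * (\<Sum>i\<in>I. (D i + G i)\<^sup>2) / w - n * (\<Sum>i\<in>I. (G i)\<^sup>2) / w)\<^sup>2
    \<le> 8 * c\<^sup>2 * (n * (\<Sum>i\<in>I. (G i)\<^sup>2) / w) / w + 2 * c ^ 4 / w"
proof -
  have w: "w \<ge> 1" using fin I by (simp add: w_def Suc_le_eq card_gt_0_iff)
  have n1: "n \<ge> 1" "n \<ge> w" using n w by (auto simp: w_def)
  define Q where "Q = (\<Sum>i\<in>I. (G i)\<^sup>2)"
  define E where "E = (\<Sum>i\<in>I. (D i)\<^sup>2)"
  define T where "T = (\<Sum>i\<in>I. D i * G i)"
  have Q: "Q \<ge> 0" and E0: "E \<ge> 0" unfolding Q_def E_def by (auto intro: sum_nonneg)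
  have "E \<le> (\<Sum>i\<in>I. (c / n)\<^sup>2)"
    unfolding E_def using D by (intro sum_mono) (metis abs_le_square_iff abs_ge_zero abs_of_nonneg order_trans)
  then have E: "E \<le> w * (c / n)\<^sup>2" by (simp add: w_def)
  have T: "T\<^sup>2 \<le> E * Q" unfolding T_def E_def Q_def by (rule Cauchy_Schwarz_ineq_sum)
  have nE: "n / w * E \<le> c\<^sup>2 / n"
  proof -
    have "n / w * E \<le> n / w * (w * (c / n)\<^sup>2)" using n1 w by (intro mult_left_mono E) auto
    also have "\<dots> = c\<^sup>2 / n" using n1 w by (simp add: power2_eq_square)
    finally show ?thesis .
  qed
  have "(\<Sum>i\<in>I. (D i + G i)\<^sup>2) = E + Q + 2 * T"
    unfolding Q_def T_def E_def by (simp add: power2_sum sum.distrib sum_distrib_left mult.assoc)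
  then have "n * (\<Sum>i\<in>I. (D i + G i)\<^sup>2) / w - n * Q / w = 2 * (n / w * T) + n / w * E"
    by (simp add: algebra_simps add_divide_distrib)
  then have "(n * (\<Sum>i\<in>I. (D i + G i)\<^sup>2) / w - n * Q / w)\<^sup>2 = (2 * (n / w * T) + n / w * E)\<^sup>2"
    by simp
  also have "\<dots> \<le> 8 * (n / w * T)\<^sup>2 + 2 * (n / w * E)\<^sup>2"
    using power2_sum_le[of "2 * (n / w * T)" "n / w * E"] by (simp add: power_mult_distrib power_divide)
  also have "(n / w * T)\<^sup>2 \<le> (n / w)\<^sup>2 * (E * Q)"
    unfolding power_mult_distrib by (intro mult_left_mono T) auto
  also have "\<dots> = (n / w * E) * (n * Q / w)" by (simp add: power2_eq_square)
  also have "\<dots> \<le> (c\<^sup>2 / n) * (n * Q / w)" using Q n1 w by (intro mult_right_mono nE) auto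
  also have "\<dots> \<le> (c\<^sup>2 / w) * (n * Q / w)" using Q n1 w by (intro mult_right_mono divide_left_mono) auto
  also have "(n / w * E)\<^sup>2 \<le> (c\<^sup>2 / n)\<^sup>2" using E0 n1 w by (intro power_mono nE) auto
  also have "\<dots> \<le> c ^ 4 / w"
  proof -
    have "w * 1 \<le> n * n" using n1 w by (intro mult_mono) auto
    then have "c ^ 4 / (n * n) \<le> c ^ 4 / w" using n1 w by (intro divide_left_mono) auto
    then show ?thesis by (simp add: power2_eq_square power4_eq_xxxx mult.assoc)
  qed
  finally show ?thesis by (simp add: Q_def mult_ac)
qed

text \<open>Three comparisons: the posterior mean \<open>\<mu>\<close> is close to the normalised sum of squares \<open>z\<close> of the observed
increments, \<open>z\<close> is close to its driftless counterpart \<open>q\<close>, and \<open>q\<close> is close to \<open>a\<close>. Each squared error is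
bounded by a multiple of \<open>x + v\<close>, where \<open>x = (q - a)\<^sup>2\<close> and \<open>v = 1 / card I\<close>; the constant depends
only on \<open>\<alpha>\<close>, \<open>\<beta>\<close>, \<open>c\<close> and \<open>S\<close>, so one constant serves all bins and all sample sizes.\<close>

lemma bin_posterior_risk_bound:
  fixes \<alpha> \<beta> c S :: real
  assumes pos: "\<alpha> > 0" "\<beta> > 0" "c \<ge> 0" "S \<ge> 0"
  shows "\<exists>C\<ge>0. \<forall>n I (D :: nat \<Rightarrow> real) G a.
    finite I \<and> 8 \<le> card I \<and> card I \<le> n \<and> \<bar>a\<bar> \<le> S \<and> (\<forall>i\<in>I. \<bar>D i\<bar> \<le> c / real n) \<longrightarrow>
    posterior_bin_risk \<alpha> \<beta> n I (\<lambda>i. D i + G i) a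
      \<le> C * ((real n * (\<Sum>i\<in>I. (G i)\<^sup>2) / real (card I) - a)\<^sup>2 + 1 / real (card I))"
proof -
  define C1 where "C1 = 16 * c\<^sup>2 + 8 * c\<^sup>2 * (1 + 2 * S\<^sup>2) + 2 * c ^ 4"
  define C2 where "C2 = 4 * C1 + 4 + 4 * S\<^sup>2"
  define C3 where "C3 = 32 * (\<beta>\<^sup>2 + (\<alpha> - 1)\<^sup>2 * C2)"
  define C where "C = 3 * C3 + 3 * C1 + 3 + 8 * (C3 + C2)"
  have C0: "C1 \<ge> 0" "C2 \<ge> 0" "C3 \<ge> 0" "C \<ge> 0"
    unfolding C1_def C2_def C3_def C_def by auto
  show ?thesis
  proof (intro exI[of _ C] conjI C0 allI impI)
    fix n I a and D G :: "nat \<Rightarrow> real"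
    assume *: "finite I \<and> 8 \<le> card I \<and> card I \<le> n \<and> \<bar>a\<bar> \<le> S \<and> (\<forall>i\<in>I. \<bar>D i\<bar> \<le> c / real n)"
    then have fin: "finite I" and w8: "8 \<le> card I" and wn: "card I \<le> n" and a: "\<bar>a\<bar> \<le> S"
      and D: "\<And>i. i \<in> I \<Longrightarrow> \<bar>D i\<bar> \<le> c / real n"
      by auto
    define w where "w = real (card I)"
    define z where "z = real n * (\<Sum>i\<in>I. (D i + G i)\<^sup>2) / w"
    define q where "q = real n * (\<Sum>i\<in>I. (G i)\<^sup>2) / w"
    define \<mu> where "\<mu> = (\<beta> + real n * (\<Sum>i\<in>I. (D i + G i)\<^sup>2) / 2) / (\<alpha> + w / 2 - 1)"
    define x where "x = (q - a)\<^sup>2"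
    define v where "v = 1 / w"
    have w: "w \<ge> 8" using w8 by (simp add: w_def)
    have v: "0 < v" "v \<le> 1" "w * v = 1" using w by (auto simp: v_def)
    have x: "x \<ge> 0" by (simp add: x_def)
    have q: "q \<ge> 0" unfolding q_def using w by (intro divide_nonneg_pos mult_nonneg_nonneg sum_nonneg) auto
    have a2: "a\<^sup>2 \<le> S\<^sup>2" using a pos by (simp add: abs_le_square_iff[symmetric])
    \<comment> \<open>All quantities are expressed through \<open>x\<close>, whose expectation is small, rather than through \<open>q\<close>.\<close>
    have q2: "q\<^sup>2 \<le> 2 * x + 2 * S\<^sup>2"
      using zero_le_power2[of "q - 2 * a"] a2 by (simp add: x_def power2_eq_square algebra_simps)
    have xv: "(x + 1) * v \<le> x + v" "(x + v) * v \<le> x + v"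
      using mult_left_mono[OF v(2) x] mult_left_mono[OF v(2), of "x + v"] x v by (auto simp: algebra_simps)
    have "(z - q)\<^sup>2 \<le> 8 * c\<^sup>2 * q * v + 2 * c ^ 4 * v"
      using perturbed_sum_squares_close[OF fin, of "real n" c D G] w8 wn pos D
      unfolding z_def q_def v_def w_def by fastforce
    also have "\<dots> \<le> 8 * c\<^sup>2 * (2 * x + (1 + 2 * S\<^sup>2)) * v + 2 * c ^ 4 * v"
    proof -
      have "q \<le> 1 + q\<^sup>2" using zero_le_power2[of "q - 1 / 2"] by (simp add: power2_eq_square algebra_simps)
      then have "q \<le> 2 * x + (1 + 2 * S\<^sup>2)" using q2 by linarith
      then show ?thesis using v by (intro add_right_mono mult_right_mono mult_left_mono) auto
    qed
    also have "\<dots> = 16 * c\<^sup>2 * (x * v) + (8 * c\<^sup>2 * (1 + 2 * S\<^sup>2) + 2 * c ^ 4) * v"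
      by (simp add: algebra_simps)
    also have "\<dots> \<le> 16 * c\<^sup>2 * (x + v) + (8 * c\<^sup>2 * (1 + 2 * S\<^sup>2) + 2 * c ^ 4) * (x + v)"
      using x v mult_left_mono[OF v(2) x] by (intro add_mono mult_left_mono) auto
    finally have zq: "(z - q)\<^sup>2 \<le> C1 * (x + v)" by (simp add: C1_def algebra_simps)
    have "z\<^sup>2 \<le> 2 * (z - q)\<^sup>2 + 2 * q\<^sup>2"
      using zero_le_power2[of "z - 2 * q"] by (simp add: power2_eq_square algebra_simps)
    also have "\<dots> \<le> 2 * (C1 * (x + 1)) + 2 * (2 * x + 2 * S\<^sup>2)"
      using order_trans[OF zq mult_left_mono[of "x + v" "x + 1", OF _ C0(1)]] v q2
      by (intro add_mono mult_left_mono) auto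
    also have "\<dots> \<le> C2 * (x + 1)"
    proof -
      have "0 \<le> 2 * C1 * (x + 1) + 4 * S\<^sup>2 * x + 4"
        using x C0 by (intro add_nonneg_nonneg mult_nonneg_nonneg) auto
      then show ?thesis by (simp add: C2_def algebra_simps)
    qed
    finally have z2: "z\<^sup>2 \<le> C2 * (x + 1)" .
    \<comment> \<open>With \<open>8 \<le> card I\<close> the second bound gives a posterior variance of at most \<open>4 * v * \<mu>\<^sup>2\<close>.\<close>
    have den: "\<alpha> + w / 2 - 1 \<ge> w / 4" "\<alpha> + w / 2 - 2 \<ge> w / 4" using w pos by linarith+
    have "\<mu> - z = (\<beta> - (\<alpha> - 1) * z) / (\<alpha> + w / 2 - 1)"
    proof -
      have "\<mu> = (\<beta> + w / 2 * z) / (\<alpha> + w / 2 - 1)" using w by (simp add: \<mu>_def z_def)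
      moreover have "\<alpha> + w / 2 - 1 \<noteq> 0" using den w by linarith
      ultimately show ?thesis by (simp add: field_simps)
    qed
    then have "\<bar>\<mu> - z\<bar> = \<bar>\<beta> - (\<alpha> - 1) * z\<bar> / (\<alpha> + w / 2 - 1)"
      using den w by (simp add: abs_divide)
    also have "\<dots> \<le> \<bar>\<beta> - (\<alpha> - 1) * z\<bar> / (w / 4)"
      using den w by (intro divide_left_mono) auto
    also have "\<dots> = \<bar>4 * v * (\<beta> - (\<alpha> - 1) * z)\<bar>"
      unfolding abs_mult using w by (simp add: v_def)
    finally have "\<bar>\<mu> - z\<bar> \<le> \<bar>4 * v * (\<beta> - (\<alpha> - 1) * z)\<bar>" .
    then have "(\<mu> - z)\<^sup>2 \<le> (4 * v * (\<beta> - (\<alpha> - 1) * z))\<^sup>2" by (simp add: abs_le_square_iff)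
    also have "\<dots> = 16 * v\<^sup>2 * (\<beta> - (\<alpha> - 1) * z)\<^sup>2" by (simp add: power_mult_distrib)
    also have "\<dots> \<le> 16 * v\<^sup>2 * (2 * (\<beta>\<^sup>2 + (\<alpha> - 1)\<^sup>2 * z\<^sup>2))"
      using zero_le_power2[of "\<beta> + (\<alpha> - 1) * z"]
      by (intro mult_left_mono) (auto simp: power2_eq_square algebra_simps)
    also have "\<dots> \<le> 16 * v\<^sup>2 * (2 * (\<beta>\<^sup>2 * (x + 1) + (\<alpha> - 1)\<^sup>2 * (C2 * (x + 1))))"
      using z2 mult_left_mono[of 1 "x + 1" "\<beta>\<^sup>2"] x by (intro mult_left_mono add_mono) auto
    also have "\<dots> = C3 * (v * ((x + 1) * v))" by (simp add: C3_def power2_eq_square algebra_simps)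
    also have "\<dots> \<le> C3 * (1 * (x + v))"
      using v x C0 xv by (intro mult_left_mono mult_mono) auto
    finally have muz: "(\<mu> - z)\<^sup>2 \<le> C3 * (x + v)" by simp
    have mu_a: "(\<mu> - a)\<^sup>2 \<le> 3 * (\<mu> - z)\<^sup>2 + 3 * (z - q)\<^sup>2 + 3 * (q - a)\<^sup>2"
    proof -
      define p1 p2 p3 where "p1 = \<mu> - z" and "p2 = z - q" and "p3 = q - a"
      have "\<mu> - a = p1 + p2 + p3" by (simp add: p1_def p2_def p3_def)
      moreover have "(p1 + p2 + p3)\<^sup>2 \<le> 3 * p1\<^sup>2 + 3 * p2\<^sup>2 + 3 * p3\<^sup>2"
        using zero_le_power2[of "p1 - p2"] zero_le_power2[of "p2 - p3"] zero_le_power2[of "p1 - p3"]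
        by (simp add: power2_eq_square algebra_simps)
      ultimately show ?thesis by (simp add: p1_def p2_def p3_def)
    qed
    have "\<mu>\<^sup>2 / (\<alpha> + w / 2 - 2) \<le> \<mu>\<^sup>2 / (w / 4)"
      using den w by (intro divide_left_mono) auto
    also have "\<dots> = 4 * v * \<mu>\<^sup>2" by (simp add: v_def)
    also have "\<dots> \<le> 4 * v * (2 * (C3 * (x + v)) + 2 * (C2 * (x + 1)))"
    proof -
      have "\<mu>\<^sup>2 \<le> 2 * (\<mu> - z)\<^sup>2 + 2 * z\<^sup>2"
        using zero_le_power2[of "\<mu> - 2 * z"] by (simp add: power2_eq_square algebra_simps)
      then show ?thesis using muz z2 v by (intro mult_left_mono) auto
    qed
    also have "\<dots> = 8 * (C3 * ((x + v) * v)) + 8 * (C2 * ((x + 1) * v))" by (simp add: algebra_simps)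
    also have "\<dots> \<le> 8 * (C3 * (x + v)) + 8 * (C2 * (x + v))"
      using C0 xv by (intro add_mono mult_left_mono) auto
    finally have var: "\<mu>\<^sup>2 / (\<alpha> + w / 2 - 2) \<le> 8 * (C3 * (x + v)) + 8 * (C2 * (x + v))" .
    have "(\<mu> - a)\<^sup>2 \<le> 3 * (C3 * (x + v)) + 3 * (C1 * (x + v)) + 3 * (x + v)"
      using mu_a muz zq v(1) unfolding x_def[symmetric] by argo
    from add_mono[OF this var] have "(\<mu> - a)\<^sup>2 + \<mu>\<^sup>2 / (\<alpha> + w / 2 - 2) \<le>
        3 * (C3 * (x + v)) + 3 * (C1 * (x + v)) + 3 * (x + v) + 8 * (C3 * (x + v)) + 8 * (C2 * (x + v))"
      by (simp only: add.assoc)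
    also have "\<dots> = C * (x + v)" by (simp add: C_def algebra_simps)
    finally show "posterior_bin_risk \<alpha> \<beta> n I (\<lambda>i. D i + G i) a
        \<le> C * ((real n * (\<Sum>i\<in>I. (G i)\<^sup>2) / real (card I) - a)\<^sup>2 + 1 / real (card I))"
      unfolding posterior_bin_risk_def posterior_bin_mean_def \<mu>_def x_def q_def v_def w_def .
  qed
qed

section \<open>Increments of the diffusion\<close>

lemma drift_increment_bound:
  fixes f :: "real \<Rightarrow> real"
  assumes ut: "0 \<le> u" "u \<le> t" and int: "set_integrable lborel {0..t} f"
    and bound: "\<And>v. v \<in> {0..t} \<Longrightarrow> \<bar>f v\<bar> \<le> c"
  shows "\<bar>(LBINT v:{0..t}. f v) - (LBINT v:{0..u}. f v)\<bar> \<le> c * (t - u)"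
proof -
  have sub: "set_integrable lborel {0..u} f" "set_integrable lborel {u<..t} f"
    using ut by (auto intro: set_integrable_subset[OF int])
  have "{0..t} = {0..u} \<union> {u<..t}" using ut by auto
  then have "(LBINT v:{0..t}. f v) - (LBINT v:{0..u}. f v) = (LBINT v:{u<..t}. f v)"
    using set_integral_Un[OF _ sub] by (auto simp: disjoint_iff)
  also have "\<bar>\<dots>\<bar> \<le> (LBINT v:{u<..t}. \<bar>f v\<bar>)"
    using set_integral_norm_bound[OF sub(2)] by simp
  also have "\<dots> \<le> (LBINT v:{u<..t}. c)"
  proof (rule set_integral_mono)
    show "set_integrable lborel {u<..t} (\<lambda>v. \<bar>f v\<bar>)" by (rule set_integrable_abs[OF sub(2)])
    show "set_integrable lborel {u<..t} (\<lambda>v. c)"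
      using ut unfolding set_integrable_def by (intro integrable_scaleR_left integrable_real_indicator) auto
    show "\<bar>f v\<bar> \<le> c" if "v \<in> {u<..t}" for v using that ut by (intro bound) auto
  qed
  also have "\<dots> = c * (t - u)"
    using ut by (subst set_integral_const) (auto simp: measure_def)
  finally show ?thesis .
qed

lemma (in prob_space) integral_le_of_nn_integral_le:
  fixes f :: "'a \<Rightarrow> real"
  assumes "f \<in> borel_measurable M" "\<And>x. 0 \<le> f x" "(\<integral>\<^sup>+x. ennreal (f x) \<partial>M) \<le> ennreal b" "0 \<le> b"
  shows "integrable M f" "integral\<^sup>L M f \<le> b"
proof -
  show int: "integrable M f"
    using assms by (intro integrableI_bounded) (auto simp: order.strict_trans1)
  show "integral\<^sup>L M f \<le> b"
    using nn_integral_eq_integral[OF int] assms by simp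
qed

lemma abs_le_if_abs_le_on_rationals:
  fixes f :: "real \<Rightarrow> real"
  assumes cont: "continuous_on {0..1} f" and bound: "\<And>q. q \<in> \<rat> \<inter> {0<..<1} \<Longrightarrow> \<bar>f q\<bar> \<le> R"
    and t: "t \<in> {0..1}"
  shows "\<bar>f t\<bar> \<le> R"
proof -
  have "closure ({0<..<1} \<inter> \<rat>) = closure {0<..<1 :: real}"
    by (rule closure_open_Int_superset) (auto simp: Rats_closure_real)
  then have cl: "closure (\<rat> \<inter> {0<..<1}) = {0..1 :: real}"
    by (simp add: Int_commute)
  have "continuous_on (closure (\<rat> \<inter> {0<..<1})) (\<lambda>t. \<bar>f t\<bar>)"
    unfolding cl by (intro continuous_on_rabs cont)
  moreover have "t \<in> closure (\<rat> \<inter> {0<..<1})" unfolding cl by (rule t)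
  ultimately show ?thesis using bound by (rule continuous_le_on_closure)
qed

locale diffusion = brownian M W for M :: "'w measure" and W :: "real \<Rightarrow> 'w \<Rightarrow> real" +
  fixes X :: "real \<Rightarrow> 'w \<Rightarrow> real" and b0 :: "real \<Rightarrow> real \<Rightarrow> real" and s0 :: "real \<Rightarrow> real"
    and K L lam :: real
  assumes K_pos: "K > 0" and drift: "drift_condition K b0" and L: "L > 0" and lam: "lam > 0"
    and disp: "dispersion_condition L lam s0" and sol: "strong_solution M W b0 s0 X"
begin

lemma X_measurable: "t \<in> {0..1} \<Longrightarrow> X t \<in> borel_measurable M"
proof -
  assume t: "t \<in> {0..1}"
  define \<A> where "\<A> = {W u -` A \<inter> space M | u A. u \<in> {0..t} \<and> A \<in> sets borel} \<union> null_sets M"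
  have \<A>: "\<A> \<subseteq> sets M"
    unfolding \<A>_def using t by (auto intro!: measurable_sets[OF W_measurable])
  then have "\<A> \<subseteq> Pow (space M)" using sets.space_closed by blast
  then have "space (sigma (space M) \<A>) = space M" "sets (sigma (space M) \<A>) = sigma_sets (space M) \<A>"
    by (simp_all add: space_measure_of_conv)
  then have "subalgebra M (augmented_filtration M W t)"
    unfolding subalgebra_def augmented_filtration_def \<A>_def[symmetric]
    using sets.sigma_sets_subset[OF \<A>] by simp
  moreover have "X t \<in> borel_measurable (augmented_filtration M W t)"
    using sol t by (simp add: strong_solution_def)
  ultimately show "X t \<in> borel_measurable M" by (rule measurable_from_subalg)
qed

text \<open>Rational times make this an event; for a continuous path they control the whole path
(\<open>abs_le_if_abs_le_on_rationals\<close>).\<close>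

definition path_within :: "real \<Rightarrow> 'w set" where
  "path_within R = {\<omega> \<in> space M. \<forall>q\<in>\<rat> \<inter> {0<..<1}. \<bar>X q \<omega>\<bar> \<le> R}"

lemma path_within_measurable: "path_within R \<in> sets M"
proof -
  have meas: "{\<omega> \<in> space M. \<bar>X q \<omega>\<bar> \<le> R} \<in> sets M" if "q \<in> \<rat> \<inter> {0<..<1}" for q
  proof -
    have [measurable]: "X q \<in> borel_measurable M" using X_measurable[of q] that by auto
    show ?thesis by measurable
  qed
  have "1 / 2 \<in> \<rat> \<inter> {0<..<1 :: real}" by simp
  then have ne: "\<rat> \<inter> {0<..<1 :: real} \<noteq> {}" by blast
  have sub: "(\<lambda>q. {\<omega> \<in> space M. \<bar>X q \<omega>\<bar> \<le> R}) ` (\<rat> \<inter> {0<..<1}) \<subseteq> sets M"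
    using meas by blast
  have "path_within R = (\<Inter>q\<in>\<rat> \<inter> {0<..<1}. {\<omega> \<in> space M. \<bar>X q \<omega>\<bar> \<le> R})"
    unfolding path_within_def using ne by blast
  also have "\<dots> \<in> sets M"
    by (rule sets.countable_INT'[OF countable_Int1[OF countable_rat] ne sub])
  finally show ?thesis .
qed

lemma prob_path_exceeds_tendsto_0: "(\<lambda>R. prob (space M - path_within (real R))) \<longlonglongrightarrow> 0"
proof -
  define B where "B R = space M - path_within (real R)" for R
  have B: "B R \<in> sets M" for R unfolding B_def using path_within_measurable by auto
  \<comment> \<open>Each continuous path is bounded, hence the decreasing events \<open>B R\<close> have a null intersection.\<close>
  have "decseq B"
  proof (intro decseq_SucI subsetI)
    fix R \<omega> assume "\<omega> \<in> B (Suc R)"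
    moreover have "path_within (real R) \<subseteq> path_within (real (Suc R))"
      unfolding path_within_def by force
    ultimately show "\<omega> \<in> B R" unfolding B_def by blast
  qed
  then have "(\<lambda>R. prob (B R)) \<longlonglongrightarrow> prob (\<Inter>R. B R)"
    using B by (intro finite_Lim_measure_decseq) auto
  also have "AE \<omega> in M. \<omega> \<notin> (\<Inter>R. B R)"
  proof -
    have "AE \<omega> in M. continuous_on {0..1} (\<lambda>t. X t \<omega>)" using sol by (simp add: strong_solution_def)
    then show ?thesis
    proof (rule AE_mp, intro AE_I2 impI)
      fix \<omega> assume \<omega>: "\<omega> \<in> space M" and "continuous_on {0..1} (\<lambda>t. X t \<omega>)"
      then have "compact ((\<lambda>t. X t \<omega>) ` {0..1})" by (intro compact_continuous_image) auto
      then have "bounded ((\<lambda>t. X t \<omega>) ` {0..1})" by (rule compact_imp_bounded)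
      then obtain r where r: "\<And>t. t \<in> {0..1} \<Longrightarrow> \<bar>X t \<omega>\<bar> \<le> r"
        unfolding bounded_real by blast
      obtain R :: nat where "r \<le> real R" using real_arch_simple by blast
      then have "\<bar>X q \<omega>\<bar> \<le> real R" if "q \<in> \<rat> \<inter> {0<..<1}" for q
        using r[of q] that by simp
      then have "\<omega> \<in> path_within (real R)" using \<omega> by (simp add: path_within_def)
      then show "\<omega> \<notin> (\<Inter>R. B R)" by (auto simp: B_def)
    qed
  qed
  then have "prob (\<Inter>R. B R) = 0"
    using B by (subst prob_eq_0) auto
  finally show ?thesis by (simp add: B_def)
qed

text \<open>While the path stays in \<open>[-R, R]\<close>, the linear growth condition bounds the drift by a constant.\<close>

lemma increments_close_to_Wiener_integral:
  "\<exists>J. (\<forall>t\<in>{0..1}. is_Wiener_integral M W s0 t (J t)) \<and>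
    (\<forall>R. AE \<omega> in M. \<omega> \<in> path_within R \<longrightarrow> (\<forall>u t. 0 \<le> u \<and> u \<le> t \<and> t \<le> 1 \<longrightarrow>
      \<bar>(X t \<omega> - X u \<omega>) - (J t \<omega> - J u \<omega>)\<bar> \<le> sqrt (K * (1 + R\<^sup>2)) * (t - u)))"
proof -
  obtain J where J: "is_Wiener_integral_process M W s0 J"
    and eq: "AE \<omega> in M. \<forall>t\<in>{0..1}. set_integrable lborel {0..t} (\<lambda>u. b0 u (X u \<omega>)) \<and>
           X t \<omega> = (LBINT u:{0..t}. b0 u (X u \<omega>)) + J t \<omega>"
    using sol unfolding strong_solution_def by blast
  have cont: "AE \<omega> in M. continuous_on {0..1} (\<lambda>t. X t \<omega>)" using sol by (simp add: strong_solution_def)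
  show ?thesis
  proof (intro exI[of _ J] conjI allI ballI)
    show "is_Wiener_integral M W s0 t (J t)" if "t \<in> {0..1}" for t
      using J that by (simp add: is_Wiener_integral_process_def)
    fix R
    show "AE \<omega> in M. \<omega> \<in> path_within R \<longrightarrow> (\<forall>u t. 0 \<le> u \<and> u \<le> t \<and> t \<le> 1 \<longrightarrow>
      \<bar>(X t \<omega> - X u \<omega>) - (J t \<omega> - J u \<omega>)\<bar> \<le> sqrt (K * (1 + R\<^sup>2)) * (t - u))"
      using eq cont
    proof eventually_elim
      case (elim \<omega>)
      show ?case
      proof (intro impI allI)
        fix u t :: real assume \<omega>: "\<omega> \<in> path_within R" and ut: "0 \<le> u \<and> u \<le> t \<and> t \<le> 1"
        have XR: "\<bar>X v \<omega>\<bar> \<le> R" if "v \<in> {0..1}" for v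
          using abs_le_if_abs_le_on_rationals[OF elim(2) _ that] \<omega> by (auto simp: path_within_def)
        have b: "\<bar>b0 v (X v \<omega>)\<bar> \<le> sqrt (K * (1 + R\<^sup>2))" if "v \<in> {0..1}" for v
        proof (rule real_le_rsqrt)
          have "(X v \<omega>)\<^sup>2 \<le> R\<^sup>2" using XR[OF that] by (simp add: abs_le_square_iff[symmetric])
          then have "K * (1 + (X v \<omega>)\<^sup>2) \<le> K * (1 + R\<^sup>2)" using K_pos by (intro mult_left_mono) auto
          moreover have "\<bar>b0 v (X v \<omega>)\<bar>\<^sup>2 \<le> K * (1 + (X v \<omega>)\<^sup>2)"
            using drift that unfolding drift_condition_def by blast
          ultimately show "\<bar>b0 v (X v \<omega>)\<bar>\<^sup>2 \<le> K * (1 + R\<^sup>2)" by linarith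
        qed
        have "\<bar>(LBINT v:{0..t}. b0 v (X v \<omega>)) - (LBINT v:{0..u}. b0 v (X v \<omega>))\<bar> \<le> sqrt (K * (1 + R\<^sup>2)) * (t - u)"
          using ut elim(1) b by (intro drift_increment_bound) auto
        moreover have "X t \<omega> = (LBINT u:{0..t}. b0 u (X u \<omega>)) + J t \<omega>"
          "X u \<omega> = (LBINT u:{0..u}. b0 u (X u \<omega>)) + J u \<omega>" using elim(1) ut by auto
        ultimately show "\<bar>(X t \<omega> - X u \<omega>) - (J t \<omega> - J u \<omega>)\<bar> \<le> sqrt (K * (1 + R\<^sup>2)) * (t - u)"
          by simp
      qed
    qed
  qed
qed

lemma s0_pos: "\<forall>u\<in>{0..1}. s0 u > 0"
  using disp by (simp add: dispersion_condition_def)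

lemma s0_holder: "u \<in> {0..1} \<Longrightarrow> v \<in> {0..1} \<Longrightarrow> \<bar>s0 u - s0 v\<bar> \<le> L * \<bar>u - v\<bar> powr lam"
  using disp by (simp add: dispersion_condition_def)

lemma s0_le: "u \<in> {0..1} \<Longrightarrow> s0 u \<le> s0 0 + L"
proof -
  assume u: "u \<in> {0..1}"
  have "\<bar>u - 0\<bar> powr lam \<le> 1" using u lam by (auto intro: powr_le1)
  then have "L * \<bar>u - 0\<bar> powr lam \<le> L * 1" using L by (intro mult_left_mono) auto
  then show ?thesis using s0_holder[OF u, of 0] by auto
qed

lemma s0_square_le: "u \<in> {0..1} \<Longrightarrow> (s0 u)\<^sup>2 \<le> (s0 0 + L)\<^sup>2"
  using s0_le s0_pos by (intro power_mono) (auto intro: less_imp_le)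

lemma s0_square_holder:
  assumes "u \<in> {0..1}" "v \<in> {0..1}"
  shows "\<bar>(s0 u)\<^sup>2 - (s0 v)\<^sup>2\<bar> \<le> 2 * (s0 0 + L) * L * \<bar>u - v\<bar> powr lam"
proof -
  have "\<bar>(s0 u)\<^sup>2 - (s0 v)\<^sup>2\<bar> = \<bar>s0 u + s0 v\<bar> * \<bar>s0 u - s0 v\<bar>"
    by (simp add: abs_mult[symmetric] power2_eq_square algebra_simps)
  also have "\<dots> \<le> (2 * (s0 0 + L)) * (L * \<bar>u - v\<bar> powr lam)"
    using s0_pos[rule_format, OF assms(1)] s0_pos[rule_format, OF assms(2)] s0_le[OF assms(1)] s0_le[OF assms(2)]
    by (intro mult_mono s0_holder assms) auto
  finally show ?thesis by simp
qed

lemma bin_location: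
  assumes m: "0 < m" "m \<le> n" and k: "k \<in> {1..num_bins n m}" and u: "u \<in> bin n m k"
  shows "u \<in> {0..1}" and "real (m * (k - 1)) / real n \<in> {0..1}"
    and "\<bar>u - real (m * (k - 1)) / real n\<bar> \<le> 2 * real m / real n"
proof -
  have n: "n > 0" using m by simp
  have lo: "real (m * (k - 1)) / real n \<le> u" using u by (auto simp: bin_def split: if_splits)
  have "m * (k - 1) \<le> m * k" "m * k \<le> n" using bin_edge_le[OF k] by auto
  then have kn: "real (m * k) / real n \<le> 1" using n by (simp del: of_nat_mult)
  show u01: "u \<in> {0..1}"
  proof -
    have "0 \<le> real (m * (k - 1)) / real n" by simp
    then have "0 \<le> u" using lo by linarith
    moreover have "u \<le> 1" using u kn by (auto simp: bin_def simp del: of_nat_mult split: if_splits)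
    ultimately show ?thesis by simp
  qed
  show "real (m * (k - 1)) / real n \<in> {0..1}"
    using lo u01 by (simp del: of_nat_mult)
  have len: "measure lborel (bin n m k) \<le> 2 * real m / real n"
    unfolding measure_bin(1)[OF m(1) k] using card_bin_cells(2)[OF m(1) k] n
    by (intro divide_right_mono) (simp_all flip: of_nat_mult)
  have "u - real (m * (k - 1)) / real n \<le> measure lborel (bin n m k)"
    using u lo by (auto simp: bin_def simp del: of_nat_mult split: if_splits)
  then show "\<bar>u - real (m * (k - 1)) / real n\<bar> \<le> 2 * real m / real n"
    using lo len by simp
qed

section \<open>The expected posterior mass\<close>

text \<open>The first term accounts for paths that leave \<open>[-R, R]\<close>, where the posterior mass is bounded by \<open>1\<close>. The
second is Markov's bound: \<open>1/m\<close> is the order of the variance on a bin of at least \<open>m\<close> cells, and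
\<open>(m/n)\<^bsup>2 lam\<^esup>\<close> that of the squared oscillation of \<open>s0\<^sup>2\<close> on an interval of length at most \<open>2m/n\<close>.\<close>

lemma expected_posterior_bound:
  assumes pos: "\<alpha> > 0" "\<beta> > 0" and R: "R \<ge> 0"
  shows "\<exists>C\<ge>0. \<forall>n m r. 8 \<le> m \<and> m \<le> n \<and> r > 0 \<longrightarrow>
    \<bar>\<integral>x. posterior \<alpha> \<beta> n m x {s. L2_norm_01 (\<lambda>u. (s u)\<^sup>2 - (s0 u)\<^sup>2) \<ge> r} \<partial>path_law M X\<bar>
      \<le> prob (space M - path_within R) + C * (1 / real m + (real m / real n) powr (2 * lam)) / r\<^sup>2"
proof -
  obtain J where J: "\<And>t. t \<in> {0..1} \<Longrightarrow> is_Wiener_integral M W s0 t (J t)"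
    and incr: "\<And>R. AE \<omega> in M. \<omega> \<in> path_within R \<longrightarrow> (\<forall>u t. 0 \<le> u \<and> u \<le> t \<and> t \<le> 1 \<longrightarrow>
      \<bar>(X t \<omega> - X u \<omega>) - (J t \<omega> - J u \<omega>)\<bar> \<le> sqrt (K * (1 + R\<^sup>2)) * (t - u))"
    using increments_close_to_Wiener_integral by blast
  have J_meas: "J t \<in> borel_measurable M" if "t \<in> {0..1}" for t
    using J[OF that] by (simp add: is_Wiener_integral_def)
  define S where "S = (s0 0 + L)\<^sup>2"
  define H where "H = 2 * (s0 0 + L) * L"
  define c where "c = \<bar>sqrt (K * (1 + R\<^sup>2))\<bar>"
  have S: "S \<ge> 0" by (simp add: S_def)
  have "s0 0 > 0" using s0_pos by simp
  then have H: "H \<ge> 0" using L by (simp add: H_def)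
  have c: "c \<ge> 0" by (simp add: c_def)
  obtain C0 where C0: "C0 \<ge> 0"
    and risk: "\<And>n I (D :: nat \<Rightarrow> real) G a.
      finite I \<and> 8 \<le> card I \<and> card I \<le> n \<and> \<bar>a\<bar> \<le> S \<and> (\<forall>i\<in>I. \<bar>D i\<bar> \<le> c / real n) \<Longrightarrow>
      posterior_bin_risk \<alpha> \<beta> n I (\<lambda>i. D i + G i) a
        \<le> C0 * ((real n * (\<Sum>i\<in>I. (G i)\<^sup>2) / real (card I) - a)\<^sup>2 + 1 / real (card I))"
    using bin_posterior_risk_bound[OF pos c S] by blast
  \<comment> \<open>The first entry collects the variance terms, the second the oscillation terms.\<close>
  define C1 where "C1 = max (2 * C0 * (2 * S\<^sup>2 + 1)) ((2 * C0 + 2) * (H\<^sup>2 * 2 powr (2 * lam)))"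
  have C1: "C1 \<ge> 0" using C0 by (simp add: C1_def le_max_iff_disj)
  show ?thesis
  proof (intro exI[of _ C1] conjI C1 allI impI)
    fix n m :: nat and r :: real assume "8 \<le> m \<and> m \<le> n \<and> r > 0"
    then have m8: "8 \<le> m" and mn: "m \<le> n" and r: "r > 0" by auto
    have m: "0 < m" and n: "n > 0" using m8 mn by auto
    define N where "N = num_bins n m"
    define T where "T = {s. L2_norm_01 (\<lambda>u. (s u)\<^sup>2 - (s0 u)\<^sup>2) \<ge> r}"
    define post where "post x = posterior \<alpha> \<beta> n m x T" for x
    define a where "a k = (s0 (real (m * (k - 1)) / real n))\<^sup>2" for k
    define \<eta> where "\<eta> = H * (2 * real m / real n) powr lam"
    define w where "w k = card (bin_cells n m k)" for k
    define G where "G i \<omega> = J (real i / real n) \<omega> - J (real (i - 1) / real n) \<omega>" for i \<omega>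
    define F where "F k \<omega> = (real n * (\<Sum>i\<in>bin_cells n m k. (G i \<omega>)\<^sup>2) / real (w k) - a k)\<^sup>2" for k \<omega>
    define \<Psi> where "\<Psi> \<omega> = (\<Sum>k=1..N. real (w k) / real n * (2 * (C0 * (F k \<omega> + 1 / real (w k))) + 2 * \<eta>\<^sup>2)) / r\<^sup>2" for \<omega>
    have \<eta>_sq: "\<eta>\<^sup>2 = (H\<^sup>2 * 2 powr (2 * lam)) * (real m / real n) powr (2 * lam)"
      using n m by (simp add: \<eta>_def power_mult_distrib powr_mult[symmetric] powr_power mult.commute)
    have osc: "\<bar>(s0 u)\<^sup>2 - a k\<bar> \<le> \<eta>" if "k \<in> {1..num_bins n m}" "u \<in> bin n m k" for k u
    proof -
      note loc = bin_location[OF m mn that]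
      have "\<bar>(s0 u)\<^sup>2 - a k\<bar> \<le> H * \<bar>u - real (m * (k - 1)) / real n\<bar> powr lam"
        unfolding a_def H_def by (rule s0_square_holder[OF loc(1,2)])
      also have "\<dots> \<le> \<eta>" unfolding \<eta>_def
        using H lam loc(3) by (intro mult_left_mono powr_mono2) auto
      finally show ?thesis .
    qed
    have w: "m \<le> w k" "w k \<le> n" if "k \<in> {1..N}" for k
      using card_bin_cells(1)[OF m, of k n] card_mono[OF _ bin_cells_subset[of k n m]] that
      by (auto simp: N_def w_def)
    have a_le: "\<bar>a k\<bar> \<le> S" if "k \<in> {1..N}" for k
    proof -
      have "m * (k - 1) \<le> m * k" "m * k \<le> n" using bin_edge_le[of k n m] that by (auto simp: N_def)
      then have "m * (k - 1) \<le> n" by (rule le_trans)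
      then have "real (m * (k - 1)) / real n \<in> {0..1}" using n by (simp del: of_nat_mult)
      then show ?thesis using s0_square_le by (simp add: a_def S_def)
    qed
    note bounds = posterior_histogram_bounds[of m n \<alpha> \<beta> r "\<lambda>u. (s0 u)\<^sup>2" a \<eta>, OF _ mn pos r osc, folded T_def, folded post_def]
    have post01: "0 \<le> post x" "post x \<le> 1" for x using bounds(1,2)[of x] m8 by auto
    define path where "path \<omega> = (\<lambda>t\<in>{0..1}. X t \<omega>)" for \<omega>
    have path_meas: "path \<in> measurable M (\<Pi>\<^sub>M t\<in>{0..1}. borel)"
      unfolding path_def[abs_def] by (intro measurable_restrict X_measurable)
    have grid: "real i / real n \<in> {0..1}" "real (i - 1) / real n \<in> {0..1}" if "i \<in> {1..n}" for i
      using that n by auto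
    have F_nn: "(\<integral>\<^sup>+\<omega>. ennreal (F k \<omega>) \<partial>M) \<le> ennreal (2 * S\<^sup>2 / real (w k) + \<eta>\<^sup>2)" if k: "k \<in> {1..N}" for k
      unfolding F_def G_def w_def
    proof (rule realized_variance_moment[where J = "\<lambda>i. J (real i / real n)" and lam = lam and L = L and s = s0])
      show "bin_cells n m k \<noteq> {}" using w(1)[OF k] m by (auto simp: w_def)
      show "bin_cells n m k \<subseteq> {1..n}" using bin_cells_subset k by (simp add: N_def)
      show "\<bar>(s0 u)\<^sup>2 - a k\<bar> \<le> \<eta>"
        if "i \<in> bin_cells n m k" "u \<in> {real (i - 1) / real n..<real i / real n}" for i u
        using cell_subset_bin[OF n _ that(1)] that(2) k by (intro osc) (auto simp: N_def)
    qed (use n lam L s0_pos s0_holder J s0_square_le S_def in auto)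
    have F_meas: "F k \<in> borel_measurable M" if "k \<in> {1..N}" for k
      unfolding F_def[abs_def] G_def using bin_cells_subset[of k n m] that grid
      by (intro borel_measurable_power borel_measurable_diff borel_measurable_divide borel_measurable_times
        borel_measurable_sum borel_measurable_const J_meas) (auto simp: N_def)
    have F: "integrable M (F k)" "integral\<^sup>L M (F k) \<le> 2 * S\<^sup>2 / real (w k) + \<eta>\<^sup>2" if k: "k \<in> {1..N}" for k
    proof -
      have nn: "0 \<le> F k \<omega>" for \<omega> by (simp add: F_def)
      have "0 \<le> 2 * S\<^sup>2 / real (w k) + \<eta>\<^sup>2" by simp
      note * = integral_le_of_nn_integral_le[OF F_meas[OF k] nn F_nn[OF k] this]
      show "integrable M (F k)" "integral\<^sup>L M (F k) \<le> 2 * S\<^sup>2 / real (w k) + \<eta>\<^sup>2"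
        by (rule *)+
    qed
    have \<Psi>_int: "integrable M \<Psi>"
      unfolding \<Psi>_def[abs_def] using F(1)
      by (intro integrable_divide_zero Bochner_Integration.integrable_sum integrable_mult_right
          Bochner_Integration.integrable_add integrable_const) auto
    have "integral\<^sup>L M \<Psi> = (\<Sum>k=1..N. real (w k) / real n * (2 * (C0 * (integral\<^sup>L M (F k) + 1 / real (w k))) + 2 * \<eta>\<^sup>2)) / r\<^sup>2"
      unfolding \<Psi>_def using F(1) by (simp add: prob_space)
    also have "\<dots> \<le> (\<Sum>k=1..N. real (w k) / real n * (C1 * (1 / real m + (real m / real n) powr (2 * lam)))) / r\<^sup>2"
    proof (intro divide_right_mono sum_mono mult_left_mono)
      fix k assume k: "k \<in> {1..N}"
      have "2 * (C0 * (integral\<^sup>L M (F k) + 1 / real (w k))) + 2 * \<eta>\<^sup>2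
          \<le> 2 * (C0 * ((2 * S\<^sup>2 / real (w k) + \<eta>\<^sup>2) + 1 / real (w k))) + 2 * \<eta>\<^sup>2"
        using F(2)[OF k] C0 by (intro add_mono mult_left_mono) auto
      also have "\<dots> = 2 * C0 * (2 * S\<^sup>2 + 1) * (1 / real (w k)) + (2 * C0 + 2) * \<eta>\<^sup>2"
        by (simp add: algebra_simps add_divide_distrib)
      also have "\<dots> \<le> 2 * C0 * (2 * S\<^sup>2 + 1) * (1 / real m) + (2 * C0 + 2) * \<eta>\<^sup>2"
        using w(1)[OF k] m C0 by (intro add_mono mult_left_mono divide_left_mono) auto
      also have "\<dots> \<le> C1 * (1 / real m) + C1 * (real m / real n) powr (2 * lam)"
        unfolding \<eta>_sq mult.assoc[symmetric, of "2 * C0 + 2"]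
        by (intro add_mono mult_right_mono) (auto simp: C1_def)
      finally show "2 * (C0 * (integral\<^sup>L M (F k) + 1 / real (w k))) + 2 * \<eta>\<^sup>2
          \<le> C1 * (1 / real m + (real m / real n) powr (2 * lam))" by (simp only: distrib_left)
    qed auto
    also have "\<dots> = C1 * (1 / real m + (real m / real n) powr (2 * lam)) / r\<^sup>2"
    proof -
      have "(\<Sum>k=1..N. real (w k) / real n) = 1"
        unfolding sum_divide_distrib[symmetric] of_nat_sum[symmetric] w_def N_def
        using sum_card_bin_cells[OF m mn] n by simp
      then show ?thesis by (simp only: sum_distrib_right[symmetric] mult_1_left)
    qed
    finally have \<Psi>_le: "integral\<^sup>L M \<Psi> \<le> C1 * (1 / real m + (real m / real n) powr (2 * lam)) / r\<^sup>2" .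
    have \<Psi>_nonneg: "\<Psi> \<omega> \<ge> 0" for \<omega>
      unfolding \<Psi>_def F_def using C0
      by (intro divide_nonneg_nonneg sum_nonneg mult_nonneg_nonneg add_nonneg_nonneg) auto
    \<comment> \<open>The pointwise bound: trivial off the event, Markov's bound on it.\<close>
    have dom: "AE \<omega> in M. post (path \<omega>) \<le> indicator (space M - path_within R) \<omega> + \<Psi> \<omega>"
      using incr[of R] AE_space
    proof eventually_elim
      case (elim \<omega>)
      show ?case
      proof (cases "\<omega> \<in> path_within R")
        case False
        then show ?thesis using post01(2)[of "path \<omega>"] \<Psi>_nonneg[of \<omega>] elim(2) by simp
      next
        case True
        define D where "D i = obs_increment n (path \<omega>) i - G i \<omega>" for i
        have D: "\<bar>D i\<bar> \<le> c / real n" if "i \<in> {1..n}" for i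
        proof -
          have ord: "0 \<le> real (i - 1) / real n \<and> real (i - 1) / real n \<le> real i / real n \<and> real i / real n \<le> 1"
            using that n by (auto simp: divide_right_mono)
          have "D i = (X (real i / real n) \<omega> - X (real (i - 1) / real n) \<omega>) -
              (J (real i / real n) \<omega> - J (real (i - 1) / real n) \<omega>)"
            using grid[OF that] by (simp add: D_def obs_increment_def path_def G_def)
          then have "\<bar>D i\<bar> \<le> sqrt (K * (1 + R\<^sup>2)) * (real i / real n - real (i - 1) / real n)"
            using elim(1) True ord by presburger
          also have "\<dots> \<le> c * (real i / real n - real (i - 1) / real n)"
            unfolding c_def using ord by (intro mult_right_mono) auto
          also have "real i / real n - real (i - 1) / real n = 1 / real n"
            using that by (simp add: diff_divide_distrib[symmetric] of_nat_diff)
          finally show ?thesis by simp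
        qed
        have obs: "obs_increment n (path \<omega>) i = D i + G i \<omega>" for i by (simp add: D_def)
        have "post (path \<omega>) \<le> (\<Sum>k=1..N. real (w k) / real n *
          (2 * posterior_bin_risk \<alpha> \<beta> n (bin_cells n m k) (\<lambda>i. D i + G i \<omega>) (a k) + 2 * \<eta>\<^sup>2)) / r\<^sup>2"
          using bounds(3)[of "path \<omega>"] m8 unfolding obs[abs_def] N_def w_def by simp
        also have "\<dots> \<le> \<Psi> \<omega>"
          unfolding \<Psi>_def
        proof (intro divide_right_mono sum_mono mult_left_mono add_mono)
          fix k assume k: "k \<in> {1..N}"
          show "posterior_bin_risk \<alpha> \<beta> n (bin_cells n m k) (\<lambda>i. D i + G i \<omega>) (a k)
            \<le> C0 * (F k \<omega> + 1 / real (w k))"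
            unfolding F_def w_def
          proof (rule risk, intro conjI ballI)
            show "8 \<le> card (bin_cells n m k)" "card (bin_cells n m k) \<le> n"
              using w[OF k] m8 by (auto simp: w_def)
            show "\<bar>D i\<bar> \<le> c / real n" if "i \<in> bin_cells n m k" for i
              using bin_cells_subset[of k n m] k that by (intro D) (auto simp: N_def)
          qed (use a_le k in auto)
        qed auto
        finally show ?thesis using elim(2) True by (simp add: indicator_def)
      qed
    qed
    have "\<bar>integral\<^sup>L (path_law M X) post\<bar> \<le> prob (space M - path_within R) + integral\<^sup>L M \<Psi>"
    \<comment> \<open>If the posterior mass is not integrable as a function of the path, its integral is \<open>0\<close>.\<close>
    proof (cases "integrable (path_law M X) post")
      case True
      then have meas: "post \<in> borel_measurable (\<Pi>\<^sub>M t\<in>{0..1}. borel)"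
        unfolding path_law_def using borel_measurable_integrable by fastforce
      have int: "integrable M (\<lambda>\<omega>. post (path \<omega>))"
        using True integrable_distr_eq[OF path_meas meas] by (simp add: path_law_def path_def[abs_def])
      have "integral\<^sup>L (path_law M X) post = (\<integral>\<omega>. post (path \<omega>) \<partial>M)"
        using integral_distr[OF path_meas meas] by (simp add: path_law_def path_def[abs_def])
      also have "\<dots> \<le> (\<integral>\<omega>. indicator (space M - path_within R) \<omega> + \<Psi> \<omega> \<partial>M)"
        using path_within_measurable
        by (intro integral_mono_AE int dom Bochner_Integration.integrable_add \<Psi>_int integrable_real_indicator)
          (auto simp: less_top[symmetric])
      also have "\<dots> = prob (space M - path_within R) + integral\<^sup>L M \<Psi>"
        using path_within_measurable \<Psi>_int
        by (subst Bochner_Integration.integral_add) (auto simp: less_top[symmetric])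
      finally show ?thesis using post01(1) by (simp add: Bochner_Integration.integral_nonneg)
    next
      case False
      then show ?thesis using \<Psi>_nonneg by (simp add: not_integrable_integral_eq Bochner_Integration.integral_nonneg)
    qed
    then show "\<bar>\<integral>x. posterior \<alpha> \<beta> n m x {s. L2_norm_01 (\<lambda>u. (s u)\<^sup>2 - (s0 u)\<^sup>2) \<ge> r} \<partial>path_law M X\<bar>
        \<le> prob (space M - path_within R) + C1 * (1 / real m + (real m / real n) powr (2 * lam)) / r\<^sup>2"
      using \<Psi>_le unfolding post_def T_def by linarith
  qed
qed

end

section \<open>Rates and the contraction theorem\<close>

text \<open>If \<open>N\<close> is the number of bins then \<open>m N \<le> n < 2 m N\<close>, so \<open>m\<close> has the order of
\<open>n / N\<close>, and both terms have the order \<open>n\<^bsup>- 2 lam / (2 lam + 1)\<^esup>\<close>.\<close>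

lemma bin_width_rate:
  fixes m :: "nat \<Rightarrow> nat" and \<epsilon> :: "nat \<Rightarrow> real" and lam :: real
  assumes lam: "lam > 0" and m: "\<And>n. n \<ge> 2 \<Longrightarrow> 0 < m n \<and> m n < n"
    and N: "(\<lambda>n. real (num_bins n (m n))) \<in> \<Theta>(\<lambda>n. real n powr (1 / (2 * lam + 1)))"
    and eps: "\<epsilon> \<in> \<Theta>(\<lambda>n. real n powr (- lam / (2 * lam + 1)))"
  shows "\<exists>C\<ge>0. \<forall>\<^sub>F n in sequentially. 1 / real (m n) + (real (m n) / real n) powr (2 * lam) \<le> C * (\<epsilon> n)\<^sup>2"
    and "\<forall>\<^sub>F n in sequentially. 8 \<le> m n"
proof -
  define p where "p = 1 / (2 * lam + 1)"
  define \<rho> where "\<rho> n = real n powr (- (2 * lam * p))" for n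
  obtain c2 where c2: "c2 > 0" and N_le: "\<forall>\<^sub>F n in sequentially. norm (real (num_bins n (m n))) \<le> c2 * norm (real n powr p)"
    using bigthetaD1[OF N] unfolding p_def by (elim landau_o.bigE)
  obtain c1 where c1: "c1 > 0" and N_ge: "\<forall>\<^sub>F n in sequentially. norm (real (num_bins n (m n))) \<ge> c1 * norm (real n powr p)"
    using bigthetaD2[OF N] unfolding p_def by (elim landau_omega.bigE)
  obtain c3 where c3: "c3 > 0" and eps_ge: "\<forall>\<^sub>F n in sequentially. norm (\<epsilon> n) \<ge> c3 * norm (real n powr (- lam / (2 * lam + 1)))"
    using bigthetaD2[OF eps] by (elim landau_omega.bigE)
  have bins: "\<forall>\<^sub>F n in sequentially. 1 / real (m n) \<le> 2 * c2 * \<rho> n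
      \<and> (real (m n) / real n) powr (2 * lam) \<le> (1 / c1) powr (2 * lam) * \<rho> n"
    using N_le N_ge eventually_ge_at_top[of 2]
  proof eventually_elim
    case (elim n)
    define b where "b = num_bins n (m n)"
    have mn: "0 < m n" "m n \<le> n" using m[OF elim(3)] by auto
    have n: "real n > 0" using elim(3) by simp
    have np: "real n powr p > 0" using n by simp
    have b: "b \<ge> 1" using num_bins_pos[OF mn] by (simp add: b_def)
    have "m n * b \<le> n" unfolding b_def by (rule num_bins_mult_le)
    then have mb: "real (m n) * real b \<le> real n" by (simp only: of_nat_mult[symmetric] of_nat_le_iff)
    have "n < m n * b + m n"
      using dividend_less_times_div[of "m n" n] mn unfolding b_def num_bins_def by linarith
    also have "m n * b + m n \<le> 2 * (m n * b)" using mult_le_mono2[OF b, of "m n"] by linarith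
    finally have "real n \<le> 2 * (real (m n) * real b)"
      by (metis of_nat_le_iff of_nat_mult of_nat_numeral less_imp_le)
    then have "1 / real (m n) \<le> 2 * real b / real n"
      using mn n by (simp add: field_simps)
    also have "\<dots> \<le> 2 * (c2 * real n powr p) / real n"
      using elim(1) n by (intro divide_right_mono mult_left_mono) (auto simp: b_def)
    also have "\<dots> = 2 * c2 * (real n powr (p - 1))" using n by (simp add: powr_diff)
    \<comment> \<open>The choice of the exponent balances the two terms.\<close>
    also have "p - 1 = - (2 * lam * p)" using lam by (simp add: p_def field_simps)
    finally have 1: "1 / real (m n) \<le> 2 * c2 * \<rho> n" by (simp add: \<rho>_def)
    have "real (m n) / real n \<le> 1 / real b" using mb n b by (simp add: field_simps)
    also have "\<dots> \<le> 1 / (c1 * real n powr p)"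
      using elim(2) np c1 b by (intro divide_left_mono) (auto simp: b_def)
    finally have "(real (m n) / real n) powr (2 * lam) \<le> (1 / (c1 * real n powr p)) powr (2 * lam)"
      using lam by (intro powr_mono2) auto
    also have "\<dots> = (1 / c1) powr (2 * lam) * (1 / real n powr p) powr (2 * lam)"
      using c1 np by (simp add: powr_mult[symmetric])
    also have "1 / real n powr p = real n powr (- p)" by (rule powr_minus_divide[symmetric])
    also have "(real n powr (- p)) powr (2 * lam) = \<rho> n" by (simp add: \<rho>_def powr_powr mult_ac)
    finally show ?case using 1 by blast
  qed
  define C where "C = (2 * c2 + (1 / c1) powr (2 * lam)) / c3\<^sup>2"
  have "\<forall>\<^sub>F n in sequentially. 1 / real (m n) + (real (m n) / real n) powr (2 * lam) \<le> C * (\<epsilon> n)\<^sup>2"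
    using bins eps_ge
  proof eventually_elim
    case (elim n)
    have "\<rho> n = (real n powr (- lam / (2 * lam + 1)))\<^sup>2"
      unfolding power2_eq_square powr_add[symmetric] by (simp add: \<rho>_def p_def)
    moreover have "(c3 * real n powr (- lam / (2 * lam + 1)))\<^sup>2 \<le> (\<epsilon> n)\<^sup>2"
      using elim(2) c3 by (subst abs_le_square_iff[symmetric]) (simp add: abs_mult)
    ultimately have "\<rho> n \<le> (\<epsilon> n)\<^sup>2 / c3\<^sup>2"
      using c3 by (simp add: power_mult_distrib pos_le_divide_eq mult.commute)
    then have "(2 * c2 + (1 / c1) powr (2 * lam)) * \<rho> n \<le> (2 * c2 + (1 / c1) powr (2 * lam)) * ((\<epsilon> n)\<^sup>2 / c3\<^sup>2)"
      using c2 by (intro mult_left_mono add_nonneg_nonneg) auto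
    also have "\<dots> = C * (\<epsilon> n)\<^sup>2" by (simp add: C_def)
    finally show ?case using elim(1) by (simp add: distrib_right)
  qed
  moreover have "C \<ge> 0" using c2 by (auto simp: C_def intro!: divide_nonneg_nonneg add_nonneg_nonneg)
  ultimately show "\<exists>C\<ge>0. \<forall>\<^sub>F n in sequentially. 1 / real (m n) + (real (m n) / real n) powr (2 * lam) \<le> C * (\<epsilon> n)\<^sup>2"
    by blast
  have "2 * lam * p > 0" using lam by (simp add: p_def)
  then have "(\<lambda>n. 2 * c2 * \<rho> n) \<longlonglongrightarrow> 2 * c2 * 0"
    unfolding \<rho>_def by (intro tendsto_mult tendsto_const tendsto_neg_powr filterlim_real_sequentially) auto
  then have "\<forall>\<^sub>F n in sequentially. 2 * c2 * \<rho> n < 1 / 8"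
    by (intro order_tendstoD(2)) auto
  with bins eventually_ge_at_top[of 2] show "\<forall>\<^sub>F n in sequentially. 8 \<le> m n"
  proof eventually_elim
    case (elim n)
    then have "1 / real (m n) < 1 / 8" by linarith
    then show ?case using m[OF elim(2)] by (simp add: field_simps)
  qed
qed

theorem theorem1:
  fixes M :: "'w measure"
    and W X :: "real \<Rightarrow> 'w \<Rightarrow> real"
    and b0 :: "real \<Rightarrow> real \<Rightarrow> real"
    and s0 :: "real \<Rightarrow> real"
    and K L lam \<alpha> \<beta> :: real
    and m :: "nat \<Rightarrow> nat"
    and \<epsilon> h :: "nat \<Rightarrow> real"
  assumes "prob_space M"
    and "standard_Brownian_motion M W"
    and "K > 0" and "drift_condition K b0"
    and "L > 0" and "0 < lam" and "lam \<le> 1" and "dispersion_condition L lam s0"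
    and "strong_solution M W b0 s0 X"
    and "\<alpha> > 0" and "\<beta> > 0"
    and "\<And>n. n \<ge> 2 \<Longrightarrow> 0 < m n \<and> m n < n"
    and "(\<lambda>n. real (num_bins n (m n))) \<in> \<Theta>(\<lambda>n. real n powr (1 / (2 * lam + 1)))"
    and "\<And>n. n \<ge> 1 \<Longrightarrow> \<epsilon> n > 0"
    and "\<epsilon> \<in> \<Theta>(\<lambda>n. real n powr (- lam / (2 * lam + 1)))"
    and "filterlim h at_top sequentially"
  shows "(\<lambda>n. \<integral>x. posterior \<alpha> \<beta> n (m n) x
               {s. L2_norm_01 (\<lambda>u. (s u)\<^sup>2 - (s0 u)\<^sup>2) \<ge> h n * \<epsilon> n} \<partial>path_law M X)
           \<longlonglongrightarrow> 0"
proof -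
  interpret prob_space M by fact
  interpret diffusion M W X b0 s0 K L lam
    by standard (use assms in auto)
  define P where "P n = (\<integral>x. posterior \<alpha> \<beta> n (m n) x
      {s. L2_norm_01 (\<lambda>u. (s u)\<^sup>2 - (s0 u)\<^sup>2) \<ge> h n * \<epsilon> n} \<partial>path_law M X)" for n
  obtain C where C: "C \<ge> 0"
    and rate: "\<forall>\<^sub>F n in sequentially. 1 / real (m n) + (real (m n) / real n) powr (2 * lam) \<le> C * (\<epsilon> n)\<^sup>2"
    using bin_width_rate(1)[OF assms(6) assms(12,13,15)] by blast
  have m8: "\<forall>\<^sub>F n in sequentially. 8 \<le> m n"
    by (rule bin_width_rate(2)[OF assms(6) assms(12,13,15)])
  have "P \<longlonglongrightarrow> 0"
  proof (rule LIMSEQ_I)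
    fix e :: real assume e: "e > 0"
    then obtain R where R: "prob (space M - path_within (real R)) < e / 2"
      using order_tendstoD(2)[OF prob_path_exceeds_tendsto_0, of "e / 2"]
      by (auto simp: eventually_sequentially)
    obtain C' where C': "C' \<ge> 0"
      and bound: "\<And>n m r. 8 \<le> m \<and> m \<le> n \<and> r > 0 \<Longrightarrow>
        \<bar>\<integral>x. posterior \<alpha> \<beta> n m x {s. L2_norm_01 (\<lambda>u. (s u)\<^sup>2 - (s0 u)\<^sup>2) \<ge> r} \<partial>path_law M X\<bar>
        \<le> prob (space M - path_within (real R)) + C' * (1 / real m + (real m / real n) powr (2 * lam)) / r\<^sup>2"
      using expected_posterior_bound[OF assms(10,11), of "real R"] by auto
    have "(\<lambda>n. C' * C * (inverse (h n))\<^sup>2) \<longlonglongrightarrow> C' * C * 0\<^sup>2"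
      using tendsto_inverse_0_at_top[OF assms(16)] by (intro tendsto_intros)
    then have "\<forall>\<^sub>F n in sequentially. C' * C * (inverse (h n))\<^sup>2 < e / 2"
      using e by (intro order_tendstoD(2)) auto
    moreover have "\<forall>\<^sub>F n in sequentially. h n > 0"
      using assms(16) by (simp add: filterlim_at_top_dense)
    ultimately have "\<forall>\<^sub>F n in sequentially. norm (P n - 0) < e"
      using rate m8 eventually_ge_at_top[of 2]
    proof eventually_elim
      case (elim n)
      have eps: "\<epsilon> n > 0" using elim(5) assms(14) by simp
      have "\<bar>P n\<bar> \<le> prob (space M - path_within (real R)) +
          C' * (1 / real (m n) + (real (m n) / real n) powr (2 * lam)) / (h n * \<epsilon> n)\<^sup>2"
        unfolding P_def using elim eps assms(12)[of n] by (intro bound) auto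
      also have "C' * (1 / real (m n) + (real (m n) / real n) powr (2 * lam)) / (h n * \<epsilon> n)\<^sup>2
          \<le> C' * (C * (\<epsilon> n)\<^sup>2) / (h n * \<epsilon> n)\<^sup>2"
        using elim(3) C' by (intro divide_right_mono mult_left_mono) auto
      also have "\<dots> = C' * C * (inverse (h n))\<^sup>2"
        using eps elim(2) by (simp add: power_mult_distrib field_simps)
      finally show ?case using elim(1) R by simp
    qed
    then show "\<exists>no. \<forall>n\<ge>no. norm (P n - 0) < e" by (simp add: eventually_sequentially)
  qed
  then show ?thesis unfolding P_def .
qed

end
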